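(* Let problem (P) and Algorithm A be as described in the context, and suppose (A1), (A2), (A3) hold. Let $(\tilde x,\tilde y,\tilde z,\tilde u)$ be the output of Algorithm A run with tolerance $\varepsilon>0$. Then $\tilde x$ is a primal $\varepsilon_P$-optimal solution of (P), with $$\varepsilon_P=\max\big\{D_u'+2+D_x(1+L_F)+(\beta_yD_p+D_u+D_u')M_p,\ D_z'\big\}\,\varepsilon .$$
   Context: **Problem and assumptions.** The problem is $$\text{(P)}\qquad \min_{x\in\mathbb{R}^n}\max_{y\in\mathbb{R}^m} F(x,y)-h(y)+g(x)\quad\text{s.t. } c(x)\le 0,\ p(y)\le 0,$$ with $c:\mathbb{R}^n\to\mathbb{R}^q$, $p:\mathbb{R}^m\to\mathbb{R}^r$. (A1): $F:\mathbb{R}^n\times\mathbb{R}^m\to\mathbb{R}$ is convex in $x$, concave in $y$, with $L_F$-Lipschitz gradient; $g$ and $h$ are proper closed convex, Lipschitz continuous (on their domains), with compact domains $\mathrm{dom}(g)\subset\mathbb{R}^n$, $\mathrm{dom}(h)\subset\mathbb{R}^m$; every component of $c$ and $p$ is convex and differentiable, and the Jacobians satisfy $\|J_c(x_1)-J_c(x_2)\|_F\le L_c\|x_1-x_2\|$, $\|J_p(y_1)-J_p(y_2)\|_F\le L_p\|y_1-y_2\|$ for all arguments. (A2): there are $x_{\rm feas}\in\mathrm{dom}(g)$, $y_{\rm feas}\in\mathrm{dom}(h)$ with $c_{\rm feas}:=\min_i(-c_i(x_{\rm feas}))>0$ and $p_{\rm feas}:=\min_i(-p_i(y_{\rm feas}))>0$.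 (A3): for any $x\in\mathrm{dom}(g)$, $F(x,\cdot)$ is $\mu_F$-strongly concave, $\mu_F>0$. **Primal $\epsilon$-optimal solution.** Let $\zeta(x)=\max_y\{F(x,y)-h(y)\ \text{s.t. } p(y)\le0\}$ and let $x^*$ be a minimizer of $\min_x\{\zeta(x)+g(x)\ \text{s.t. } c(x)\le0\}$. A point $x$ is a primal $\epsilon$-optimal solution of (P) if $|\zeta(x)+g(x)-\zeta(x^* )-g(x^* )|\le\epsilon$ and $\|[c(x)]_+\|\le\epsilon$. Here $[a]_+=\max\{a,0\}$ componentwise and $\|\cdot\|$ is the Euclidean norm (operator norm for matrices). **$\varepsilon$-KKT point.** $(x,y)$ is an $\varepsilon$-KKT point of (P) if there are multipliers $z\ge0$, $u\ge 0$ with $\mathrm{dist}(0,\nabla_xF(x,y)+\partial g(x)+J_c(x)^\top z)\le\varepsilon$, $\|[c(x)]_+\|\le\varepsilon$, $\sum_{i=1}^q|c_i(x)z_i|\le\varepsilon$, $\mathrm{dist}(0,\nabla_yF(x,y)-\partial h(y)-J_p(y)^\top u)\le\varepsilon$, $\|[p(y)]_+\|\le\varepsilon$, $\sum_{i=1}^r|p_i(y)u_i|\le\varepsilon$. **Functions.** For a fixed $\beta_y>0$, $Q(x,y,u)=F(x,y)-h(y)-\frac1{2\beta_y}\left(\|[\beta_yp(y)+u]_+\|^2-\|u\|^2\right)$, $\Psi(x,u)=\max_yQ(x,y,u)$, and $\vartheta_t(x,u,z;\beta,\rho)=\Psi(x,u)+g(x)+\frac1{2\beta}\|[\beta c(x)+z]_+\|^2-\frac1{2\beta}\|z\|^2+\frac\rho2(\|x-x^t\|^2+\|u-u^t\|^2)$.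 **Algorithm A (adaptive inexact proximal augmented Lagrangian method).** Inputs: $\varepsilon>0$; $x^0\in\mathrm{dom}(g)$, $y^0\in\mathrm{dom}(h)$, $u^0\ge0$, $z^0\ge0$; $\beta_y,\beta_{x,0},\rho_0,\eta_0>0$; $\tau>\sigma>1$. Set $\beta_{x,t}=\beta_{x,0}\sigma^t$, $\rho_t=\rho_0\sigma^{-t}$, $\eta_t=\eta_0\tau^{-t}$. For $t=0,1,\dots$: 1. by an inexact accelerated proximal gradient subroutine started at $(x^t,u^t)$, obtain $(x^{t+1},u^{t+1})$ with $x^{t+1}\in\mathrm{dom}(g)$ such that $\mathrm{dist}(0,\partial_{(x,u)}\vartheta_t(x^{t+1},u^{t+1},z^t;\beta_{x,t},\rho_t))\le\eta_t$; 2. by the exact-gradient version of the subroutine started at $y^t$, obtain $y^{t+1}\in\mathrm{dom}(h)$ with $\mathrm{dist}(0,\nabla_yF(x^{t+1},y^{t+1})-\partial h(y^{t+1})-J_p(y^{t+1})^\top[\beta_yp(y^{t+1})+u^{t+1}]_+)\le\min\{\varepsilon,\eta_t\}\mu_F$; 3. set $z^{t+1}=[\beta_{x,t}c(x^{t+1})+z^t]_+$, $\tilde u^{t+1}=[\beta_yp(y^{t+1})+u^{t+1}]_+$; 4. if $(x^{t+1},y^{t+1})$ is an $\varepsilon$-KKT point of (P) with multipliers $z^{t+1},\tilde u^{t+1}$, return (output) $(x^{t+1},y^{t+1},z^{t+1},\tilde u^{t+1})$ and stop. **Constants.** $D_x=\max_{x_1,x_2\in\mathrm{dom}(g)}\|x_1-x_2\|$;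 $D_p=\max_{y\in\mathrm{dom}(h)}\|p(y)\|$; $M_p=\max_{y\in\mathrm{dom}(h)}\|J_p(y)\|$; $\Delta_F=\max_{x\in\mathrm{dom}(g),\,y_1,y_2\in\mathrm{dom}(h)}|F(x,y_1)-F(x,y_2)|$; $\Delta_h=\max_{y_1,y_2\in\mathrm{dom}(h)}|h(y_1)-h(y_2)|$; $D_u'=\frac{\Delta_F+\Delta_h}{p_{\rm feas}}$; $D_u=\max\left(\|u^0\|,\frac{\Delta_F+\Delta_h}{p_{\rm feas}}\right)+\frac{\eta_0}{\rho_0}\frac{\tau}{\tau-\sigma}+\beta_y\eta_0\frac{\tau}{\tau-1}$; $\Delta_\Psi=\max_{x_1,x_2\in\mathrm{dom}(g),\,\|u\|\le D_u}|\Psi(x_1,u)-\Psi(x_2,u)|$; $\Delta_g=\max_{x_1,x_2\in\mathrm{dom}(g)}|g(x_1)-g(x_2)|$; $D_z'=\frac{\Delta_\Psi+\Delta_g}{c_{\rm feas}}$. *)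

theory Defs
  imports "HOL-Analysis.Analysis"
begin

definition edom :: "('a \<Rightarrow> ereal) \<Rightarrow> 'a set" where
  "edom f = {x. f x < \<infinity>}"

definition ereal_epigraph :: "('a \<Rightarrow> ereal) \<Rightarrow> ('a \<times> real) set" where
  "ereal_epigraph f = {(x, r). f x \<le> ereal r}"

definition proper_closed_convex :: "('a::euclidean_space \<Rightarrow> ereal) \<Rightarrow> bool" where
  "proper_closed_convex f \<longleftrightarrow>
     (\<forall>x. f x \<noteq> -\<infinity>) \<and> edom f \<noteq> {} \<and> closed (ereal_epigraph f) \<and> convex (ereal_epigraph f)"

definition subdiff :: "('a::real_inner \<Rightarrow> ereal) \<Rightarrow> 'a \<Rightarrow> 'a set" where
  "subdiff f x = {v. \<bar>f x\<bar> \<noteq> \<infinity> \<and> (\<forall>y. f x + ereal (v \<bullet> (y - x)) \<le> f y)}"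

text \<open>Extended-valued, so that the distance to the empty set is \<open>\<infinity>\<close>; the library's
  \<^const>\<open>infdist\<close> is 0 in that case.\<close>
definition dist0 :: "'a::real_normed_vector set \<Rightarrow> ereal" where
  "dist0 S = (INF v\<in>S. ereal (norm v))"

definition gradient :: "('a::real_inner \<Rightarrow> real) \<Rightarrow> 'a \<Rightarrow> 'a" where
  "gradient f x = (THE D. GDERIV f x :> D)"

definition strongly_concave_on :: "'a::real_inner set \<Rightarrow> real \<Rightarrow> ('a \<Rightarrow> real) \<Rightarrow> bool" where
  "strongly_concave_on S \<mu> f \<longleftrightarrow> convex S \<and>
     (\<forall>a\<in>S. \<forall>b\<in>S. \<forall>s\<in>{0..1}.
        (1 - s) * f a + s * f b + \<mu> / 2 * s * (1 - s) * (norm (a - b))\<^sup>2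
          \<le> f ((1 - s) *\<^sub>R a + s *\<^sub>R b))"

definition pos_part :: "real ^ 'k \<Rightarrow> real ^ 'k" where
  "pos_part a = (\<chi> i. max (a $ i) 0)"

abbreviation Jac :: "(real ^ 'a \<Rightarrow> real ^ 'b) \<Rightarrow> real ^ 'a \<Rightarrow> real ^ 'a ^ 'b" where
  "Jac f x \<equiv> jacobian f (at x)"

text \<open>The norm of a matrix of type \<^typ>\<open>real^'n^'q\<close> is its Frobenius norm.\<close>
definition smooth_convex_constraint :: "real \<Rightarrow> (real ^ 'n \<Rightarrow> real ^ 'q) \<Rightarrow> bool" where
  "smooth_convex_constraint L c \<longleftrightarrow>
     (\<forall>i. convex_on UNIV (\<lambda>x. c x $ i) \<and> (\<forall>x. (\<lambda>x. c x $ i) differentiable (at x))) \<and>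
     (\<forall>x1 x2. norm (Jac c x1 - Jac c x2) \<le> L * norm (x1 - x2))"

definition nonsmooth_term :: "('a::euclidean_space \<Rightarrow> ereal) \<Rightarrow> bool" where
  "nonsmooth_term g \<longleftrightarrow> proper_closed_convex g \<and> compact (edom g) \<and>
     (\<exists>L. L-lipschitz_on (edom g) (\<lambda>x. real_of_ereal (g x)))"

definition smooth_coupling :: "real \<Rightarrow> (real ^ 'n \<Rightarrow> real ^ 'm \<Rightarrow> real) \<Rightarrow> bool" where
  "smooth_coupling L F \<longleftrightarrow>
     (\<forall>y. convex_on UNIV (\<lambda>x. F x y)) \<and> (\<forall>x. concave_on UNIV (\<lambda>y. F x y)) \<and>
     (\<forall>w. (\<lambda>(x, y). F x y) differentiable (at w)) \<and>
     L-lipschitz_on UNIV (gradient (\<lambda>(x, y). F x y))"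

definition zeta ::
  "(real ^ 'n \<Rightarrow> real ^ 'm \<Rightarrow> real) \<Rightarrow> (real ^ 'm \<Rightarrow> ereal) \<Rightarrow> (real ^ 'm \<Rightarrow> real ^ 'r) \<Rightarrow> real ^ 'n \<Rightarrow> ereal" where
  "zeta F h p x = (SUP y\<in>{y. p y \<le> 0}. ereal (F x y) - h y)"

definition primal_eps_optimal ::
  "(real ^ 'n \<Rightarrow> real ^ 'm \<Rightarrow> real) \<Rightarrow> (real ^ 'n \<Rightarrow> ereal) \<Rightarrow> (real ^ 'm \<Rightarrow> ereal) \<Rightarrow>
   (real ^ 'n \<Rightarrow> real ^ 'q) \<Rightarrow> (real ^ 'm \<Rightarrow> real ^ 'r) \<Rightarrow> real \<Rightarrow> real ^ 'n \<Rightarrow> bool" where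
  "primal_eps_optimal F g h c p \<epsilon> x \<longleftrightarrow>
     (\<exists>xs. is_arg_min (\<lambda>x. zeta F h p x + g x) (\<lambda>x. c x \<le> 0) xs \<and>
        \<bar>(zeta F h p x + g x) - (zeta F h p xs + g xs)\<bar> \<le> ereal \<epsilon>) \<and>
     norm (pos_part (c x)) \<le> \<epsilon>"

definition eps_KKT_with ::
  "(real ^ 'n \<Rightarrow> real ^ 'm \<Rightarrow> real) \<Rightarrow> (real ^ 'n \<Rightarrow> ereal) \<Rightarrow> (real ^ 'm \<Rightarrow> ereal) \<Rightarrow>
   (real ^ 'n \<Rightarrow> real ^ 'q) \<Rightarrow> (real ^ 'm \<Rightarrow> real ^ 'r) \<Rightarrow> real \<Rightarrow>
   real ^ 'n \<Rightarrow> real ^ 'm \<Rightarrow> real ^ 'q \<Rightarrow> real ^ 'r \<Rightarrow> bool" where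
  "eps_KKT_with F g h c p \<epsilon> x y z u \<longleftrightarrow>
     0 \<le> z \<and> 0 \<le> u \<and>
     dist0 {gradient (\<lambda>x. F x y) x + v + transpose (Jac c x) *v z | v. v \<in> subdiff g x} \<le> ereal \<epsilon> \<and>
     norm (pos_part (c x)) \<le> \<epsilon> \<and>
     (\<Sum>i\<in>UNIV. \<bar>c x $ i * z $ i\<bar>) \<le> \<epsilon> \<and>
     dist0 {gradient (F x) y - v - transpose (Jac p y) *v u | v. v \<in> subdiff h y} \<le> ereal \<epsilon> \<and>
     norm (pos_part (p y)) \<le> \<epsilon> \<and>
     (\<Sum>i\<in>UNIV. \<bar>p y $ i * u $ i\<bar>) \<le> \<epsilon>"

definition Q_fun ::
  "(real ^ 'n \<Rightarrow> real ^ 'm \<Rightarrow> real) \<Rightarrow> (real ^ 'm \<Rightarrow> ereal) \<Rightarrow> (real ^ 'm \<Rightarrow> real ^ 'r) \<Rightarrow> real \<Rightarrow>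
   real ^ 'n \<Rightarrow> real ^ 'm \<Rightarrow> real ^ 'r \<Rightarrow> ereal" where
  "Q_fun F h p \<beta>y x y u =
     ereal (F x y) - h y
       - ereal (1 / (2 * \<beta>y) * ((norm (pos_part (\<beta>y *\<^sub>R p y + u)))\<^sup>2 - (norm u)\<^sup>2))"

definition Psi ::
  "(real ^ 'n \<Rightarrow> real ^ 'm \<Rightarrow> real) \<Rightarrow> (real ^ 'm \<Rightarrow> ereal) \<Rightarrow> (real ^ 'm \<Rightarrow> real ^ 'r) \<Rightarrow> real \<Rightarrow>
   real ^ 'n \<Rightarrow> real ^ 'r \<Rightarrow> ereal" where
  "Psi F h p \<beta>y x u = (SUP y. Q_fun F h p \<beta>y x y u)"

definition vartheta ::
  "(real ^ 'n \<Rightarrow> real ^ 'm \<Rightarrow> real) \<Rightarrow> (real ^ 'n \<Rightarrow> ereal) \<Rightarrow> (real ^ 'm \<Rightarrow> ereal) \<Rightarrow>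
   (real ^ 'n \<Rightarrow> real ^ 'q) \<Rightarrow> (real ^ 'm \<Rightarrow> real ^ 'r) \<Rightarrow> real \<Rightarrow>
   real ^ 'n \<Rightarrow> real ^ 'r \<Rightarrow> real ^ 'n \<Rightarrow> real ^ 'r \<Rightarrow> real ^ 'q \<Rightarrow> real \<Rightarrow> real \<Rightarrow> ereal" where
  "vartheta F g h c p \<beta>y xt ut x u z \<beta> \<rho> =
     Psi F h p \<beta>y x u + g x +
     ereal (1 / (2 * \<beta>) * (norm (pos_part (\<beta> *\<^sub>R c x + z)))\<^sup>2 - 1 / (2 * \<beta>) * (norm z)\<^sup>2
            + \<rho> / 2 * ((norm (x - xt))\<^sup>2 + (norm (u - ut))\<^sup>2))"

text \<open>The result of iteration \<open>t\<close>, with \<open>\<beta> = \<beta>\<^sub>x\<^sub>,\<^sub>t\<close>, \<open>\<rho> = \<rho>\<^sub>t\<close>, \<open>\<eta> = \<eta>\<^sub>t\<close>. The two inner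
  subroutines enter through the termination guarantees of their results, so every outcome
  meeting these guarantees is admitted. In particular the starting point \<open>y\<^sup>t\<close> of the second
  subroutine does not occur.\<close>
definition alg_step ::
  "(real ^ 'n \<Rightarrow> real ^ 'm \<Rightarrow> real) \<Rightarrow> (real ^ 'n \<Rightarrow> ereal) \<Rightarrow> (real ^ 'm \<Rightarrow> ereal) \<Rightarrow>
   (real ^ 'n \<Rightarrow> real ^ 'q) \<Rightarrow> (real ^ 'm \<Rightarrow> real ^ 'r) \<Rightarrow> real \<Rightarrow> real \<Rightarrow> real \<Rightarrow>
   real \<Rightarrow> real \<Rightarrow> real \<Rightarrow>
   real ^ 'n \<Rightarrow> real ^ 'r \<Rightarrow> real ^ 'q \<Rightarrow>
   real ^ 'n \<Rightarrow> real ^ 'm \<Rightarrow> real ^ 'r \<Rightarrow> real ^ 'q \<Rightarrow> real ^ 'r \<Rightarrow> bool" where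
  "alg_step F g h c p \<mu>F \<beta>y \<epsilon> \<beta> \<rho> \<eta> xt ut zt x' y' u' z' ut' \<longleftrightarrow>
     x' \<in> edom g \<and>
     dist0 (subdiff (\<lambda>(x, u). vartheta F g h c p \<beta>y xt ut x u zt \<beta> \<rho>) (x', u')) \<le> ereal \<eta> \<and>
     y' \<in> edom h \<and>
     dist0 {gradient (F x') y' - v - transpose (Jac p y') *v pos_part (\<beta>y *\<^sub>R p y' + u')
            | v. v \<in> subdiff h y'} \<le> ereal (min \<epsilon> \<eta> * \<mu>F) \<and>
     z' = pos_part (\<beta> *\<^sub>R c x' + zt) \<and>
     ut' = pos_part (\<beta>y *\<^sub>R p y' + u')"

definition alg_output ::
  "(real ^ 'n \<Rightarrow> real ^ 'm \<Rightarrow> real) \<Rightarrow> (real ^ 'n \<Rightarrow> ereal) \<Rightarrow> (real ^ 'm \<Rightarrow> ereal) \<Rightarrow>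
   (real ^ 'n \<Rightarrow> real ^ 'q) \<Rightarrow> (real ^ 'm \<Rightarrow> real ^ 'r) \<Rightarrow> real \<Rightarrow> real \<Rightarrow> real \<Rightarrow>
   real \<Rightarrow> real \<Rightarrow> real \<Rightarrow> real \<Rightarrow> real \<Rightarrow>
   real ^ 'n \<Rightarrow> real ^ 'm \<Rightarrow> real ^ 'r \<Rightarrow> real ^ 'q \<Rightarrow>
   real ^ 'n \<Rightarrow> real ^ 'm \<Rightarrow> real ^ 'q \<Rightarrow> real ^ 'r \<Rightarrow> bool" where
  "alg_output F g h c p \<mu>F \<beta>y \<epsilon> \<beta>0 \<rho>0 \<eta>0 \<sigma> \<tau> x0 y0 u0 z0 x_out y_out z_out u_out \<longleftrightarrow>
     (\<exists>x y u z ut T.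
        x 0 = x0 \<and> y 0 = y0 \<and> u 0 = u0 \<and> z 0 = z0 \<and>
        (\<forall>t\<le>T. alg_step F g h c p \<mu>F \<beta>y \<epsilon> (\<beta>0 * \<sigma> ^ t) (\<rho>0 / \<sigma> ^ t) (\<eta>0 / \<tau> ^ t)
                 (x t) (u t) (z t)
                 (x (Suc t)) (y (Suc t)) (u (Suc t)) (z (Suc t)) (ut (Suc t))) \<and>
        (\<forall>t<T. \<not> eps_KKT_with F g h c p \<epsilon> (x (Suc t)) (y (Suc t)) (z (Suc t)) (ut (Suc t))) \<and>
        eps_KKT_with F g h c p \<epsilon> (x (Suc T)) (y (Suc T)) (z (Suc T)) (ut (Suc T)) \<and>
        x_out = x (Suc T) \<and> y_out = y (Suc T) \<and> z_out = z (Suc T) \<and> u_out = ut (Suc T))"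

text \<open>The real suprema below are over nonempty bounded sets under the standing assumptions,
  and they are attained.\<close>

definition max_norm :: "(real ^ 'm \<Rightarrow> ereal) \<Rightarrow> (real ^ 'm \<Rightarrow> real ^ 'r) \<Rightarrow> real" where
  "max_norm h p = (SUP y\<in>edom h. norm (p y))"

definition max_Jac_opnorm :: "(real ^ 'm \<Rightarrow> ereal) \<Rightarrow> (real ^ 'm \<Rightarrow> real ^ 'r) \<Rightarrow> real" where
  "max_Jac_opnorm h p = (SUP y\<in>edom h. onorm ((*v) (Jac p y)))"

definition max_diff :: "('a \<Rightarrow> ereal) \<Rightarrow> real" where
  "max_diff h = (SUP (y1, y2)\<in>edom h \<times> edom h. \<bar>real_of_ereal (h y1) - real_of_ereal (h y2)\<bar>)"

definition Delta_F ::
  "(real ^ 'n \<Rightarrow> real ^ 'm \<Rightarrow> real) \<Rightarrow> (real ^ 'n \<Rightarrow> ereal) \<Rightarrow> (real ^ 'm \<Rightarrow> ereal) \<Rightarrow> real" where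
  "Delta_F F g h = (SUP (x, y1, y2)\<in>edom g \<times> edom h \<times> edom h. \<bar>F x y1 - F x y2\<bar>)"

definition Delta_Psi ::
  "(real ^ 'n \<Rightarrow> real ^ 'm \<Rightarrow> real) \<Rightarrow> (real ^ 'n \<Rightarrow> ereal) \<Rightarrow> (real ^ 'm \<Rightarrow> ereal) \<Rightarrow>
   (real ^ 'm \<Rightarrow> real ^ 'r) \<Rightarrow> real \<Rightarrow> real \<Rightarrow> real" where
  "Delta_Psi F g h p \<beta>y D =
     (SUP (x1, x2, u)\<in>edom g \<times> edom g \<times> {u. norm u \<le> D}.
        \<bar>real_of_ereal (Psi F h p \<beta>y x1 u) - real_of_ereal (Psi F h p \<beta>y x2 u)\<bar>)"

end

theory Submission
  imports Defs
begin

text \<open>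
  Write \<open>x'\<close>, \<open>y'\<close>, \<open>u\<close> for the last iterates, \<open>\<epsilon>\<close> for the tolerance, \<open>\<zeta>\<close> for the inner value function
  and \<open>xs\<close> for a primal solution. Both halves of the estimate of the gap
  \<open>\<zeta> x' + g x' - \<zeta> xs - g xs\<close> rest on Lagrange duality under Slater's condition
  (\<open>slater_multiplier\<close>), which also bounds the norm of the multipliers.

  For the upper half, the computed \<open>y'\<close> is replaced by the exact maximizer \<open>y\<close> of the augmented
  Lagrangian \<open>Q x' \<cdot> u\<close>. Strong concavity gives \<open>norm (y - y') \<le> \<epsilon>\<close>, because the residual of the
  second subroutine is at most \<open>\<epsilon>\<close> times the modulus (\<open>maximizer_distance\<close>). The point \<open>y\<close> also
  maximizes the ordinary Lagrangian with the updated multiplier \<open>w\<close>, the positive part of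
  \<open>\<beta> p y + u\<close>, so that \<open>\<zeta> x' \<le> F x' y - h y - w \<bullet> p y\<close>. Conversely \<open>\<zeta> xs\<close> is at least
  \<open>F xs y - h y\<close> up to an optimal inner multiplier times the violation of \<open>p y \<le> 0\<close>. The two are
  linked by the stationarity of \<open>x'\<close> (\<open>primal_stationarity_bound\<close>), where moving from \<open>y'\<close> to \<open>y\<close>
  costs at most \<open>\<epsilon>\<close> times the Lipschitz constant of the gradient times the diameter of the domain of
  \<open>g\<close>. The term
  \<open>w \<bullet> p y\<close> is controlled by the approximate complementarity at \<open>y'\<close> and by the norm of \<open>u\<close>
  (\<open>near_complementarity\<close>).

  For the lower half, an optimal multiplier of \<open>c x \<le> 0\<close> bounds the gain that a constraint
  violation of \<open>\<epsilon>\<close> can buy. Its norm is at most the decrease of \<open>\<zeta> + g\<close> from the Slater point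
  to \<open>xs\<close>, divided by the slack. The function \<open>\<zeta>\<close> is the minimum of \<open>\<Psi>\<close> over \<open>u\<close>, attained at an
  optimal inner multiplier, which bounds that decrease by the oscillation of \<open>\<Psi>\<close>
  (\<open>zeta_real_diff_le_Delta_Psi\<close>).

  It remains to bound \<open>norm u\<close>. If \<open>u\<close> is longer than every optimal inner multiplier is known to
  be, the multiplier update does not lengthen it (\<open>updated_norm_le\<close>), so shrinking \<open>u\<close> radially
  does not increase \<open>\<Psi>\<close> (\<open>val_shrink_le\<close>). Testing the approximate proximal step in this radial
  direction shows that each iteration lengthens \<open>u\<close> by at most the ratio of accuracy to proximal
  weight (\<open>prox_step_multiplier_bound\<close>), and these ratios form a geometric series.
\<close>

section \<open>Positive parts and the augmented Lagrangian penalty\<close>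

text \<open>The function \<open>\<lambda>a. (max a 0)\<^sup>2\<close> is convex with the 2-Lipschitz derivative \<open>\<lambda>a. 2 * max a 0\<close>: the first
inequality is the tangent bound, the second one the descent lemma.\<close>
lemma sq_max_0_bounds:
  fixes a b :: real
  shows "(max a 0)\<^sup>2 + 2 * (max a 0 * (b - a)) \<le> (max b 0)\<^sup>2"
    and "(max b 0)\<^sup>2 \<le> (max a 0)\<^sup>2 + 2 * (max a 0 * (b - a)) + (b - a)\<^sup>2"
proof -
  have "0 \<le> (b - a)\<^sup>2" by simp
  moreover have "2 * (a * (b - a)) + a\<^sup>2 = b\<^sup>2 - (b - a)\<^sup>2"
    by (simp add: power2_eq_square algebra_simps)
  moreover have "b \<le> 0 \<Longrightarrow> 0 \<le> a \<Longrightarrow> a * b \<le> 0" by (simp add: mult_nonneg_nonpos)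
  moreover have "a \<le> 0 \<Longrightarrow> 0 \<le> b \<Longrightarrow> b\<^sup>2 \<le> (b - a)\<^sup>2" by (simp add: power_mono)
  ultimately show "(max a 0)\<^sup>2 + 2 * (max a 0 * (b - a)) \<le> (max b 0)\<^sup>2"
    and "(max b 0)\<^sup>2 \<le> (max a 0)\<^sup>2 + 2 * (max a 0 * (b - a)) + (b - a)\<^sup>2"
    by (auto simp: max_def power2_eq_square algebra_simps)
qed

lemma power2_norm_vec: "(norm (a :: real ^ 'k))\<^sup>2 = (\<Sum>i\<in>UNIV. (a $ i)\<^sup>2)"
  unfolding power2_norm_eq_inner inner_vec_def by (simp add: power2_eq_square)

lemma sq_norm_pos_part_bounds:
  fixes a b :: "real ^ 'k"
  shows "(norm (pos_part a))\<^sup>2 + 2 * (pos_part a \<bullet> (b - a)) \<le> (norm (pos_part b))\<^sup>2"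
    and "(norm (pos_part b))\<^sup>2 \<le> (norm (pos_part a))\<^sup>2 + 2 * (pos_part a \<bullet> (b - a)) + (norm (b - a))\<^sup>2"
  unfolding power2_norm_vec inner_vec_def sum_distrib_left sum.distrib[symmetric]
  by (auto intro!: sum_mono sq_max_0_bounds simp: pos_part_def)

lemma pos_part_nonneg: "0 \<le> pos_part a"
  by (simp add: less_eq_vec_def pos_part_def)

lemma pos_part_of_nonneg: "0 \<le> a \<Longrightarrow> pos_part a = a"
  by (simp add: less_eq_vec_def pos_part_def vec_eq_iff max_def order_antisym)

lemma inner_pos_part: "pos_part a \<bullet> a = (norm (pos_part a))\<^sup>2"
  unfolding power2_norm_vec inner_vec_def
  by (auto intro!: sum.cong simp: pos_part_def max_def power2_eq_square)

lemma norm_pos_part_le_diff: "norm (pos_part b) \<le> norm (pos_part a) + norm (b - a)"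
proof -
  have "norm (pos_part b - pos_part a) \<le> norm (b - a)"
    by (rule norm_le_componentwise_cart) (auto simp: pos_part_def max_def)
  then show ?thesis using norm_triangle_sub[of "pos_part b" "pos_part a"] by linarith
qed

lemma inner_nonneg_le_pos_part:
  assumes "0 \<le> (u :: real ^ 'k)" shows "u \<bullet> a \<le> norm u * norm (pos_part a)"
proof -
  have "u \<bullet> a \<le> u \<bullet> pos_part a"
    unfolding inner_vec_def using assms
    by (intro sum_mono) (auto simp: pos_part_def less_eq_vec_def intro: mult_left_mono)
  also have "\<dots> \<le> norm u * norm (pos_part a)" by (rule norm_cauchy_schwarz)
  finally show ?thesis .
qed

lemma slack_times_norm_le:
  fixes v a :: "real ^ 'k"
  assumes v: "0 \<le> v" and a: "\<And>i. a $ i \<le> - d" and d: "0 \<le> d"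
  shows "d * norm v \<le> - (v \<bullet> a)"
proof -
  have "norm v \<le> (\<Sum>i\<in>UNIV. v $ i)"
    using norm_le_l1_cart[of v] v by (simp add: less_eq_vec_def)
  then have "d * norm v \<le> (\<Sum>i\<in>UNIV. v $ i * d)"
    using d by (simp add: sum_distrib_right[symmetric] mult.commute[of d] mult_right_mono)
  also have "\<dots> \<le> (\<Sum>i\<in>UNIV. v $ i * - (a $ i))"
    using v a by (intro sum_mono mult_left_mono) (auto simp: less_eq_vec_def le_minus_iff)
  finally show ?thesis by (simp add: inner_vec_def sum_negf)
qed

lemma inner_nonneg_nonpos:
  fixes v a :: "real ^ 'k"
  assumes "0 \<le> v" "a \<le> 0" shows "v \<bullet> a \<le> 0"
  unfolding inner_vec_def using assms
  by (intro sum_nonpos) (auto simp: less_eq_vec_def mult_nonneg_nonpos)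

text \<open>The term subtracted from the objective in the augmented Lagrangian; \<open>a\<close> stands for the value of
the constraint function and \<open>u\<close> for the multiplier.\<close>
definition penalty :: "real \<Rightarrow> real ^ 'r \<Rightarrow> real ^ 'r \<Rightarrow> real" where
  "penalty \<beta> a u = 1 / (2 * \<beta>) * ((norm (pos_part (\<beta> *\<^sub>R a + u)))\<^sup>2 - (norm u)\<^sup>2)"

context
  fixes \<beta> :: real
  assumes \<beta>: "\<beta> > 0"
begin

lemma twice_penalty:
  "2 * \<beta> * penalty \<beta> a u = (norm (pos_part (\<beta> *\<^sub>R a + u)))\<^sup>2 - (norm u)\<^sup>2"
  using \<beta> by (simp add: penalty_def)

lemma le_if_twice_le: "2 * \<beta> * x \<le> 2 * \<beta> * y \<Longrightarrow> x \<le> y"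
  using \<beta> by simp

text \<open>The penalty is convex and \<open>\<beta>\<close>-smooth in the constraint value, and its gradient there is the
updated multiplier. This lemma and the next one bound it by its tangents from both sides.\<close>
lemma penalty_ge_tangent:
  "penalty \<beta> a u + pos_part (\<beta> *\<^sub>R a + u) \<bullet> (b - a) \<le> penalty \<beta> b u"
proof -
  have "(norm (pos_part (\<beta> *\<^sub>R a + u)))\<^sup>2 + 2 * \<beta> * (pos_part (\<beta> *\<^sub>R a + u) \<bullet> (b - a))
      \<le> (norm (pos_part (\<beta> *\<^sub>R b + u)))\<^sup>2"
    using sq_norm_pos_part_bounds(1)[of "\<beta> *\<^sub>R a + u" "\<beta> *\<^sub>R b + u"]
    by (simp add: scaleR_diff_right[symmetric])
  then show ?thesis by - (rule le_if_twice_le, simp add: distrib_left twice_penalty)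
qed

lemma penalty_le_tangent:
  "penalty \<beta> b u \<le> penalty \<beta> a u + pos_part (\<beta> *\<^sub>R a + u) \<bullet> (b - a) + \<beta> / 2 * (norm (b - a))\<^sup>2"
proof -
  have "(norm (pos_part (\<beta> *\<^sub>R b + u)))\<^sup>2 \<le>
      (norm (pos_part (\<beta> *\<^sub>R a + u)))\<^sup>2 + 2 * \<beta> * (pos_part (\<beta> *\<^sub>R a + u) \<bullet> (b - a))
        + \<beta>\<^sup>2 * (norm (b - a))\<^sup>2"
    using sq_norm_pos_part_bounds(2)[of "\<beta> *\<^sub>R b + u" "\<beta> *\<^sub>R a + u"] \<beta>
    by (simp add: scaleR_diff_right[symmetric] power_mult_distrib)
  then show ?thesis using \<beta> by (simp add: penalty_def field_simps power2_eq_square)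
qed

text \<open>The penalty is concave in the multiplier, with gradient equal to the scaled multiplier step.\<close>
lemma penalty_le_tangent_multiplier:
  "penalty \<beta> a v \<le> penalty \<beta> a u + (pos_part (\<beta> *\<^sub>R a + u) - u) \<bullet> (v - u) / \<beta>"
proof -
  have "(norm (pos_part (\<beta> *\<^sub>R a + v)))\<^sup>2 \<le>
      (norm (pos_part (\<beta> *\<^sub>R a + u)))\<^sup>2 + 2 * (pos_part (\<beta> *\<^sub>R a + u) \<bullet> (v - u))
        + (norm (v - u))\<^sup>2"
    using sq_norm_pos_part_bounds(2)[of "\<beta> *\<^sub>R a + v" "\<beta> *\<^sub>R a + u"] by simp
  moreover have "(norm (v - u))\<^sup>2 = (norm v)\<^sup>2 - (norm u)\<^sup>2 - 2 * (u \<bullet> (v - u))"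
    by (simp add: power2_norm_eq_inner algebra_simps inner_commute)
  ultimately show ?thesis using \<beta>
    by - (rule le_if_twice_le, simp add: distrib_left twice_penalty inner_diff_left)
qed

lemma penalty_nonpos:
  assumes "a \<le> 0" shows "penalty \<beta> a u \<le> 0"
proof -
  have "norm (pos_part (\<beta> *\<^sub>R a + u)) \<le> norm u"
  proof (rule norm_le_componentwise_cart)
    fix i
    have "\<beta> * a $ i \<le> 0" using assms \<beta> by (simp add: less_eq_vec_def mult_nonneg_nonpos)
    then show "norm (pos_part (\<beta> *\<^sub>R a + u) $ i) \<le> norm (u $ i)" by (auto simp: pos_part_def)
  qed
  then show ?thesis using \<beta> by (simp add: penalty_def divide_le_0_iff)
qed

text \<open>The tangent at constraint value 0 is the unpenalised Lagrangian term.\<close>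
lemma penalty_ge_linear:
  assumes "0 \<le> u" shows "u \<bullet> a \<le> penalty \<beta> a u"
  using penalty_ge_tangent[of 0 u a] assms by (simp add: pos_part_of_nonneg penalty_def)

text \<open>Transfers approximate complementarity from \<open>b\<close> to \<open>a\<close>. In each coordinate the function
\<open>\<lambda>s. - s * max (\<beta> * s + w) 0\<close> is positive only for \<open>s\<close> between \<open>- w / \<beta>\<close> and 0, and its
positive part is Lipschitz with constant \<open>\<bar>w\<bar>\<close>, independently of \<open>\<beta>\<close>.\<close>
lemma near_complementarity:
  "- (pos_part (\<beta> *\<^sub>R a + u) \<bullet> a)
     \<le> (\<Sum>i\<in>UNIV. \<bar>b $ i * pos_part (\<beta> *\<^sub>R b + u) $ i\<bar>) + norm u * norm (a - b)"
proof -
  have scalar: "- (max (\<beta> * s + w) 0 * s) \<le> \<bar>s' * max (\<beta> * s' + w) 0\<bar> + \<bar>w\<bar> * \<bar>s - s'\<bar>"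
    for s s' w :: real
  proof (cases "s < 0 \<and> \<beta> * s + w > 0")
    case False
    then have "max (\<beta> * s + w) 0 * s \<ge> 0" by (auto simp: max_def)
    then show ?thesis by (smt (verit) abs_ge_zero mult_nonneg_nonneg)
  next
    case True
    then have w: "w > 0" using \<beta> by (smt (verit) mult_pos_neg)
    consider "s' \<ge> 0" | "s' < 0" "\<beta> * s' + w > 0" | "s' < 0" "\<beta> * s' + w \<le> 0" by linarith
    then show ?thesis
    proof cases
      case 1
      have "- (s * (\<beta> * s + w)) \<le> w * (s' - s)"
      proof -
        have "0 \<le> s' * w" "0 \<le> \<beta> * (s * s)" using \<beta> w 1 by simp_all
        then show ?thesis by (simp add: algebra_simps)
      qed
      then have "- ((\<beta> * s + w) * s) \<le> \<bar>w\<bar> * \<bar>s - s'\<bar>"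
        using True w 1 by (simp add: mult.commute)
      moreover have "max (\<beta> * s + w) 0 = \<beta> * s + w" using True by simp
      ultimately show ?thesis by (smt (verit) abs_ge_zero)
    next
      case 2
      \<comment> \<open>The difference quotient \<open>\<beta> * (s' + s) + w\<close> lies between \<open>- w\<close> and \<open>w\<close>.\<close>
      have eq: "- ((\<beta> * s + w) * s) = - (s' * (\<beta> * s' + w)) + (s' - s) * (\<beta> * (s' + s) + w)"
        by (simp add: algebra_simps)
      have "\<beta> * s < 0" "\<beta> * s' < 0" using \<beta> 2 True by (simp_all add: mult_pos_neg)
      moreover have "\<beta> * (s' + s) = \<beta> * s' + \<beta> * s" by (rule distrib_left)
      ultimately have "\<bar>\<beta> * (s' + s) + w\<bar> \<le> w" using 2 True by linarith
      then have "\<bar>(s' - s) * (\<beta> * (s' + s) + w)\<bar> \<le> \<bar>s' - s\<bar> * w"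
        by (simp add: abs_mult mult_left_mono)
      then have "(s' - s) * (\<beta> * (s' + s) + w) \<le> w * \<bar>s - s'\<bar>"
        by (simp add: mult.commute abs_minus_commute)
      moreover have "- (s' * (\<beta> * s' + w)) \<le> \<bar>s' * (\<beta> * s' + w)\<bar>" by simp
      ultimately show ?thesis using True 2 w eq by (simp add: max_def)
    next
      case 3
      \<comment> \<open>Here \<open>s'\<close> is left of the zero \<open>- w / \<beta>\<close> of the factor \<open>\<beta> * s + w\<close>, so
        \<open>\<beta> * s + w \<le> \<beta> * (s - s')\<close>.\<close>
      have "- s * \<beta> \<le> w" using True by (simp add: mult.commute)
      then have "- s * \<beta> * (\<beta> * s + w) \<le> w * (\<beta> * s + w)"
        using True by (intro mult_right_mono) auto
      also have "\<dots> \<le> w * (\<beta> * (s - s'))"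
        using 3 w by (intro mult_left_mono) (auto simp: algebra_simps)
      finally have "\<beta> * (- s * (\<beta> * s + w)) \<le> \<beta> * (w * (s - s'))"
        by (simp add: algebra_simps)
      then have "- s * (\<beta> * s + w) \<le> w * (s - s')"
        using \<beta> by (simp only: mult_le_cancel_left_pos)
      also have "\<dots> \<le> w * \<bar>s - s'\<bar>" using w by (intro mult_left_mono) auto
      finally show ?thesis using True 3 w by (simp add: max_def mult.commute)
    qed
  qed
  have "- (pos_part (\<beta> *\<^sub>R a + u) \<bullet> a) = (\<Sum>i\<in>UNIV. - (max (\<beta> * a $ i + u $ i) 0 * a $ i))"
    by (simp add: inner_vec_def pos_part_def sum_negf)
  also have "\<dots> \<le> (\<Sum>i\<in>UNIV. \<bar>b $ i * pos_part (\<beta> *\<^sub>R b + u) $ i\<bar> + \<bar>u $ i\<bar> * \<bar>a $ i - b $ i\<bar>)"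
    using scalar by (intro sum_mono) (simp add: pos_part_def)
  also have "\<dots> = (\<Sum>i\<in>UNIV. \<bar>b $ i * pos_part (\<beta> *\<^sub>R b + u) $ i\<bar>)
      + (\<chi> i. \<bar>u $ i\<bar>) \<bullet> (\<chi> i. \<bar>(a - b) $ i\<bar>)"
    by (simp add: sum.distrib inner_vec_def)
  also have "(\<chi> i. \<bar>u $ i\<bar>) \<bullet> (\<chi> i. \<bar>(a - b) $ i\<bar>) \<le> norm (\<chi> i. \<bar>u $ i\<bar>) * norm (\<chi> i. \<bar>(a - b) $ i\<bar>)"
    by (rule norm_cauchy_schwarz)
  also have "\<dots> = norm u * norm (a - b)" by (simp add: norm_vec_def)
  finally show ?thesis by simp
qed

end

section \<open>Lagrange multipliers under Slater's condition\<close>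

text \<open>Existence of Lagrange multipliers for a concave program with a Slater point \<open>y0\<close>, together with
the bound on their norm by the optimality gap of \<open>y0\<close> divided by its slack \<open>d\<close>. The set of all
\<open>(a, b)\<close> such that some \<open>y\<close> has \<open>p y \<le> a\<close> and value at least \<open>b\<close> is convex and misses the ray
above \<open>(0, V)\<close>; a normal \<open>(\<alpha>, \<gamma>)\<close> of a separating hyperplane has \<open>\<alpha> \<le> 0\<close> and \<open>\<gamma> \<ge> 0\<close>, the Slater
point excludes \<open>\<gamma> = 0\<close>, and \<open>- \<alpha> / \<gamma>\<close> is the multiplier.\<close>
lemma slater_multiplier:
  fixes p :: "'a::real_vector \<Rightarrow> real ^ 'r"
  assumes concave: "concave_on S f" and convex: "\<And>i. convex_on S (\<lambda>y. p y $ i)"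
    and y0: "y0 \<in> S" and d: "d > 0" and slater: "\<And>i. p y0 $ i \<le> - d"
    and V: "\<And>y. y \<in> S \<Longrightarrow> p y \<le> 0 \<Longrightarrow> f y \<le> V"
  obtains u where "0 \<le> u" "\<And>y. y \<in> S \<Longrightarrow> f y - u \<bullet> p y \<le> V" "d * norm u \<le> V - f y0"
proof -
  define C where "C = {(a, b). \<exists>y\<in>S. p y \<le> a \<and> b \<le> f y}"
  define B where "B = {0 :: real ^ 'r} \<times> {V<..}"
  have "convex C"
    unfolding convex_def
  proof (intro ballI allI impI)
    fix w w' :: "(real ^ 'r) \<times> real" and s t :: real
    assume w: "w \<in> C" "w' \<in> C" and st: "0 \<le> s" "0 \<le> t" "s + t = 1"
    obtain a b a' b' y y' where ww: "w = (a, b)" "w' = (a', b')"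
      and y: "y \<in> S" "p y \<le> a" "b \<le> f y" and y': "y' \<in> S" "p y' \<le> a'" "b' \<le> f y'"
      using w by (auto simp: C_def)
    have "s *\<^sub>R y + t *\<^sub>R y' \<in> S"
      using concave y y' st by (auto simp: concave_on_def convex_on_def convex_def)
    moreover have "p (s *\<^sub>R y + t *\<^sub>R y') \<le> s *\<^sub>R a + t *\<^sub>R a'"
      unfolding less_eq_vec_def
    proof
      fix i
      have "p (s *\<^sub>R y + t *\<^sub>R y') $ i \<le> s * p y $ i + t * p y' $ i"
        using convex y y' st by (auto simp: convex_on_def)
      also have "\<dots> \<le> s * a $ i + t * a' $ i"
        using y y' st by (intro add_mono mult_left_mono) (auto simp: less_eq_vec_def)
      finally show "p (s *\<^sub>R y + t *\<^sub>R y') $ i \<le> (s *\<^sub>R a + t *\<^sub>R a') $ i" by simp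
    qed
    moreover have "s * b + t * b' \<le> f (s *\<^sub>R y + t *\<^sub>R y')"
    proof -
      have "s * b + t * b' \<le> s * f y + t * f y'"
        using y y' st by (intro add_mono mult_left_mono) auto
      also have "- f (s *\<^sub>R y + t *\<^sub>R y') \<le> s * - f y + t * - f y'"
        using concave y y' st unfolding concave_on_def convex_on_def by blast
      then have "s * f y + t * f y' \<le> f (s *\<^sub>R y + t *\<^sub>R y')" by simp
      finally show ?thesis .
    qed
    ultimately show "s *\<^sub>R w + t *\<^sub>R w' \<in> C" by (auto simp: ww C_def)
  qed
  moreover have "convex B" unfolding B_def by (intro convex_Times) auto
  moreover have "(p y0, f y0) \<in> C" using y0 by (auto simp: C_def)
  moreover have "(0, V + 1) \<in> B" by (auto simp: B_def)
  moreover have "C \<inter> B = {}" using V by (force simp: C_def B_def)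
  ultimately obtain n k where n: "n \<noteq> 0" and Ck: "\<forall>w\<in>C. n \<bullet> w \<le> k" and Bk: "\<forall>w\<in>B. n \<bullet> w \<ge> k"
    using separating_hyperplane_sets[of C B] by blast
  define \<alpha> \<gamma> where "\<alpha> = fst n" and "\<gamma> = snd n"
  have C': "\<alpha> \<bullet> a + \<gamma> * b \<le> k" if "y \<in> S" "p y \<le> a" "b \<le> f y" for a b y
    using Ck that by (fastforce simp: C_def \<alpha>_def \<gamma>_def inner_prod_def)
  have Vk: "k \<le> \<gamma> * V"
  proof (rule ccontr)
    assume "\<not> k \<le> \<gamma> * V"
    then have pos: "0 < k - \<gamma> * V" by simp
    have B': "k \<le> \<gamma> * (V + e)" if "e > 0" for e
      using Bk that by (auto simp: B_def \<gamma>_def inner_prod_def)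
    \<comment> \<open>So small that \<open>\<gamma> * e\<close> uses up at most half of the assumed excess.\<close>
    define e where "e = (k - \<gamma> * V) / (2 * (\<bar>\<gamma>\<bar> + 1))"
    have "e > 0" using pos by (simp add: e_def)
    have "\<gamma> * e \<le> (\<bar>\<gamma>\<bar> + 1) * e" using \<open>e > 0\<close> by (intro mult_right_mono) auto
    also have "\<dots> = (k - \<gamma> * V) / 2" by (simp add: e_def field_simps)
    finally show False using B'[OF \<open>e > 0\<close>] pos by (simp add: algebra_simps)
  qed
  have \<alpha>0: "\<alpha> $ i \<le> 0" for i
  proof (rule ccontr)
    assume "\<not> \<alpha> $ i \<le> 0"
    then have pos: "\<alpha> $ i > 0" by simp
    \<comment> \<open>Raising the constraint bound in coordinate \<open>i\<close> by \<open>r\<close> would cross the hyperplane.\<close>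
    define r where "r = (\<bar>k - \<alpha> \<bullet> p y0 - \<gamma> * f y0\<bar> + 1) / \<alpha> $ i"
    have "r \<ge> 0" using pos by (simp add: r_def)
    have "\<alpha> \<bullet> (p y0 + axis i r) + \<gamma> * f y0 \<le> k"
      using \<open>r \<ge> 0\<close> by (intro C'[OF y0]) (auto simp: less_eq_vec_def axis_def)
    moreover have "\<alpha> \<bullet> axis i r = \<alpha> $ i * r" by (simp add: inner_axis)
    moreover have "\<alpha> $ i * r = \<bar>k - \<alpha> \<bullet> p y0 - \<gamma> * f y0\<bar> + 1" using pos by (simp add: r_def)
    ultimately show False by (simp add: inner_add_right)
  qed
  have \<gamma>0: "\<gamma> \<ge> 0"
  proof (rule ccontr)
    assume "\<not> \<gamma> \<ge> 0"
    then have neg: "\<gamma> < 0" by simp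
    \<comment> \<open>Lowering the value by \<open>r\<close> would cross the hyperplane.\<close>
    define r where "r = (\<bar>k - \<alpha> \<bullet> p y0 - \<gamma> * f y0\<bar> + 1) / - \<gamma>"
    have "r \<ge> 0" unfolding r_def using neg by (intro divide_nonneg_pos) auto
    have "\<alpha> \<bullet> p y0 + \<gamma> * (f y0 - r) \<le> k"
      using \<open>r \<ge> 0\<close> by (intro C'[OF y0]) auto
    moreover have "\<gamma> * r = - (\<bar>k - \<alpha> \<bullet> p y0 - \<gamma> * f y0\<bar> + 1)" using neg by (simp add: r_def field_simps)
    ultimately show False by (simp add: algebra_simps)
  qed
  have slack: "d * norm v \<le> - (v \<bullet> p y0)" if "0 \<le> v" for v
    using slack_times_norm_le[OF that slater] d by simp
  have "\<gamma> > 0"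
  proof (rule ccontr)
    assume "\<not> \<gamma> > 0"
    then have "\<gamma> = 0" using \<gamma>0 by simp
    then have "\<alpha> \<bullet> p y0 \<le> 0" using C'[OF y0, of "p y0" "f y0"] Vk by simp
    then have "d * norm (- \<alpha>) \<le> 0" using slack[of "- \<alpha>"] \<alpha>0 by (auto simp: less_eq_vec_def)
    then have "\<alpha> = 0" using d by (simp add: mult_le_0_iff)
    then show False using n \<open>\<gamma> = 0\<close> by (simp add: \<alpha>_def \<gamma>_def prod_eq_iff)
  qed
  define u where "u = - (1 / \<gamma>) *\<^sub>R \<alpha>"
  have u0: "0 \<le> u" using \<alpha>0 \<open>\<gamma> > 0\<close> by (simp add: u_def less_eq_vec_def divide_nonpos_pos)
  have dual: "f y - u \<bullet> p y \<le> V" if "y \<in> S" for y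
  proof -
    have "\<alpha> \<bullet> p y + \<gamma> * f y \<le> \<gamma> * V" using C'[OF that order_refl order_refl] Vk by simp
    then show ?thesis using \<open>\<gamma> > 0\<close> by (simp add: u_def field_simps)
  qed
  have "d * norm u \<le> V - f y0" using slack[OF u0] dual[OF y0] by simp
  then show ?thesis using that u0 dual by blast
qed

section \<open>Maximizing an augmented Lagrangian\<close>

lemma nonpos_if_le_small_multiples:
  fixes x C :: real
  assumes "\<And>s. 0 < s \<Longrightarrow> s < 1 \<Longrightarrow> x \<le> s * C"
  shows "x \<le> 0"
proof (rule tendsto_lowerbound)
  show "((\<lambda>s. s * C) \<longlongrightarrow> 0) (at_right 0)" by (auto intro!: tendsto_eq_intros)
  show "\<forall>\<^sub>F s in at_right 0. x \<le> s * C"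
    unfolding eventually_at_right_field using assms by (intro exI[of _ 1]) auto
qed auto

text \<open>A concave program with the Slater point \<open>y0\<close> of slack \<open>d\<close>. For the minimax problem it is the
inner problem at a fixed \<open>x\<close>.\<close>
locale penalised_program =
  fixes S :: "'a::euclidean_space set" and f :: "'a \<Rightarrow> real" and p :: "'a \<Rightarrow> real ^ 'r"
    and K d \<beta> :: real and y0 :: 'a
  assumes compact: "compact S"
    and concave: "concave_on S f" and continuous: "continuous_on S f"
    and convex: "\<And>i. convex_on S (\<lambda>y. p y $ i)" and lipschitz: "K-lipschitz_on S p"
    and y0: "y0 \<in> S" and d: "d > 0" and slater: "\<And>i. p y0 $ i \<le> - d"
    and \<beta>: "\<beta> > 0"
begin

definition updated :: "'a \<Rightarrow> real ^ 'r \<Rightarrow> real ^ 'r" where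
  "updated y u = pos_part (\<beta> *\<^sub>R p y + u)"

definition objective :: "real ^ 'r \<Rightarrow> 'a \<Rightarrow> real" where
  "objective u y = f y - penalty \<beta> (p y) u"

definition maximizes :: "'a \<Rightarrow> real ^ 'r \<Rightarrow> bool" where
  "maximizes y u \<longleftrightarrow> y \<in> S \<and> (\<forall>y'\<in>S. objective u y' \<le> objective u y)"

definition val :: "real ^ 'r \<Rightarrow> real" where
  "val u = (SUP y\<in>S. objective u y)"

lemma convex_S: "convex S"
  using concave by (simp add: concave_on_def convex_on_def)

lemma maximizer_exists: obtains y where "maximizes y u"
proof -
  have "continuous_on S p" using lipschitz by (rule lipschitz_on_continuous_on)
  then have "continuous_on S (objective u)"
    unfolding objective_def penalty_def pos_part_def
    by (intro continuous_intros continuous continuous_on_compose2[OF _ \<open>continuous_on S p\<close>]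
          continuous_on_vec_lambda) auto
  then obtain y where "y \<in> S" "\<forall>y'\<in>S. objective u y' \<le> objective u y"
    using continuous_attains_sup[OF compact] y0 by blast
  then show thesis using that by (auto simp: maximizes_def)
qed

lemma val_eq: "maximizes y u \<Longrightarrow> val u = objective u y"
  unfolding val_def maximizes_def by (intro cSup_eq_maximum) auto

lemma objective_le_val: "y \<in> S \<Longrightarrow> objective u y \<le> val u"
  by (metis maximizer_exists maximizes_def val_eq)

lemma p_convex_combination:
  assumes "0 \<le> w" "y \<in> S" "y' \<in> S" "0 \<le> s" "s \<le> 1"
  shows "w \<bullet> p ((1 - s) *\<^sub>R y + s *\<^sub>R y') \<le> w \<bullet> ((1 - s) *\<^sub>R p y + s *\<^sub>R p y')"
  unfolding inner_vec_def
proof (intro sum_mono)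
  fix i
  have "p ((1 - s) *\<^sub>R y + s *\<^sub>R y') $ i \<le> (1 - s) * p y $ i + s * p y' $ i"
    using convex[of i] assms by (auto simp: convex_on_def)
  then show "w $ i \<bullet> p ((1 - s) *\<^sub>R y + s *\<^sub>R y') $ i \<le> w $ i \<bullet> ((1 - s) *\<^sub>R p y + s *\<^sub>R p y') $ i"
    using assms(1) by (simp add: less_eq_vec_def mult_left_mono)
qed

text \<open>The first-order condition for the augmented Lagrangian coincides with that for the ordinary
Lagrangian at the updated multiplier. Since \<open>f\<close> and \<open>p\<close> may be nonsmooth, the optimality of
\<open>y\<close> is tested against points at distance \<open>O(s)\<close> on the segment to \<open>y'\<close>: the penalty exceeds its
linearization only by \<open>O(s\<^sup>2)\<close>. The number \<open>m\<close> carries a strong concavity gain along the segment.\<close>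
lemma maximizer_maximizes_Lagrangian:
  assumes max: "maximizes y u" and y': "y' \<in> S"
    and m: "\<And>s. 0 < s \<Longrightarrow> s < 1 \<Longrightarrow>
      (1 - s) * f y + s * f y' + s * (1 - s) * m \<le> f ((1 - s) *\<^sub>R y + s *\<^sub>R y')"
  shows "f y' - updated y u \<bullet> p y' + m \<le> f y - updated y u \<bullet> p y"
proof -
  let ?w = "updated y u"
  have y: "y \<in> S" using max by (simp add: maximizes_def)
  define C where "C = \<beta> / 2 * (K * norm (y' - y))\<^sup>2"
  have "(f y' - ?w \<bullet> p y' + m) - (f y - ?w \<bullet> p y) \<le> s * (C + m)" if s: "0 < s" "s < 1" for s
  proof -
    define v where "v = (1 - s) *\<^sub>R y + s *\<^sub>R y'"
    have v: "v \<in> S" unfolding v_def using convex_S y y' s by (intro convexD) auto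
    have "v - y = s *\<^sub>R (y' - y)" by (simp add: v_def algebra_simps)
    then have "norm (v - y) = s * norm (y' - y)" using s by simp
    then have "norm (p v - p y) \<le> s * (K * norm (y' - y))"
      using lipschitz_onD[OF lipschitz v y] by (simp add: dist_norm mult.left_commute)
    then have "(norm (p v - p y))\<^sup>2 \<le> (s * (K * norm (y' - y)))\<^sup>2" by (intro power_mono) auto
    then have "\<beta> / 2 * (norm (p v - p y))\<^sup>2 \<le> s\<^sup>2 * C"
      using \<beta> by (simp add: C_def power_mult_distrib mult_left_mono)
    moreover have "?w \<bullet> (p v - p y) \<le> s * (?w \<bullet> (p y' - p y))"
      using p_convex_combination[of ?w y y' s] y y' s
      by (simp add: v_def updated_def pos_part_nonneg inner_diff_right inner_add_right algebra_simps)
    moreover have "penalty \<beta> (p v) u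
        \<le> penalty \<beta> (p y) u + ?w \<bullet> (p v - p y) + \<beta> / 2 * (norm (p v - p y))\<^sup>2"
      unfolding updated_def by (rule penalty_le_tangent[OF \<beta>])
    moreover have "f v - penalty \<beta> (p v) u \<le> f y - penalty \<beta> (p y) u"
      using max v by (auto simp: maximizes_def objective_def)
    moreover have "(1 - s) * f y + s * f y' + s * (1 - s) * m \<le> f v"
      using m s by (simp add: v_def)
    ultimately have "s * ((f y' - ?w \<bullet> p y' + m) - (f y - ?w \<bullet> p y)) \<le> s * (s * (C + m))"
      by (simp add: algebra_simps power2_eq_square)
    then show ?thesis using s by simp
  qed
  from nonpos_if_le_small_multiples[OF this] show ?thesis by simp
qed

lemma maximizer_maximizes_Lagrangian_weak:
  assumes "maximizes y u" "y' \<in> S"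
  shows "f y' - updated y u \<bullet> p y' \<le> f y - updated y u \<bullet> p y"
proof -
  have "(1 - s) * f y + s * f y' + s * (1 - s) * 0 \<le> f ((1 - s) *\<^sub>R y + s *\<^sub>R y')"
    if "0 < s" "s < 1" for s
  proof -
    have "- f ((1 - s) *\<^sub>R y + s *\<^sub>R y') \<le> (1 - s) * - f y + s * - f y'"
      using concave assms that unfolding concave_on_def convex_on_def maximizes_def by auto
    then show ?thesis by simp
  qed
  from maximizer_maximizes_Lagrangian[OF assms this] show ?thesis by simp
qed

text \<open>If the updated multiplier \<open>w\<close> were longer than \<open>u\<close>, then \<open>\<beta> * (w \<bullet> p y) = (norm w)\<^sup>2 - w \<bullet> u\<close> would
be nonnegative. Comparing the Lagrangian at \<open>y\<close> and at the Slater point would then give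
\<open>d * norm w \<le> \<Delta>\<close>, hence \<open>norm w \<le> norm u\<close>.\<close>
lemma updated_norm_le:
  assumes max: "maximizes y u" and D: "\<And>y. y \<in> S \<Longrightarrow> f y - f y0 \<le> \<Delta>"
    and u: "\<Delta> / d \<le> norm u"
  shows "norm (updated y u) \<le> norm u"
proof (rule ccontr)
  let ?w = "updated y u"
  assume "\<not> norm ?w \<le> norm u"
  then have big: "norm u < norm ?w" by simp
  have w0: "0 \<le> ?w" by (simp add: updated_def pos_part_nonneg)
  have y: "y \<in> S" using max by (simp add: maximizes_def)
  have "?w \<bullet> u \<le> norm ?w * norm u" by (rule norm_cauchy_schwarz)
  also have "\<dots> \<le> (norm ?w)\<^sup>2" using big by (simp add: power2_eq_square mult_left_mono)
  finally have "0 \<le> (norm ?w)\<^sup>2 - ?w \<bullet> u" by simp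
  also have "(norm ?w)\<^sup>2 - ?w \<bullet> u = \<beta> * (?w \<bullet> p y)"
    using inner_pos_part[of "\<beta> *\<^sub>R p y + u"] by (simp add: updated_def inner_add_right)
  finally have "0 \<le> ?w \<bullet> p y" using \<beta> by (simp add: zero_le_mult_iff)
  have "d * norm ?w \<le> - (?w \<bullet> p y0)" using slack_times_norm_le[OF w0 slater] d by simp
  also have "\<dots> \<le> f y - f y0"
    using maximizer_maximizes_Lagrangian_weak[OF max y0] \<open>0 \<le> ?w \<bullet> p y\<close> by simp
  also have "\<dots> \<le> \<Delta>" by (rule D[OF y])
  also have "\<dots> \<le> d * norm u" using u d by (simp add: field_simps)
  finally show False using big d by simp
qed

text \<open>The value is convex in the multiplier, with a subgradient \<open>(v - w) / \<beta>\<close> at \<open>v = (1 - s) *\<^sub>R u\<close>, where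
\<open>w\<close> is the updated multiplier. As \<open>norm w \<le> norm v\<close>, that subgradient has a nonnegative inner product
with the radial direction. No differentiability of the value is involved.\<close>
lemma val_shrink_le:
  assumes D: "\<And>y. y \<in> S \<Longrightarrow> f y - f y0 \<le> \<Delta>"
    and s: "0 \<le> s" "s < 1" and u: "\<Delta> / d \<le> (1 - s) * norm u"
  shows "val ((1 - s) *\<^sub>R u) \<le> val u"
proof -
  let ?v = "(1 - s) *\<^sub>R u"
  obtain y where max: "maximizes y ?v" by (rule maximizer_exists)
  let ?w = "updated y ?v"
  have "norm ?w \<le> norm ?v" using s u by (intro updated_norm_le[OF max D]) auto
  then have "?w \<bullet> ?v \<le> norm ?v * norm ?v"
    using norm_cauchy_schwarz[of ?w ?v] by (meson mult_right_mono norm_ge_zero order_trans)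
  then have "(?w - ?v) \<bullet> ?v \<le> 0"
    by (simp only: inner_diff_left power2_norm_eq_inner[symmetric] power2_eq_square[symmetric])
  then have "(1 - s) * ((?w - ?v) \<bullet> u) \<le> 0" by simp
  then have "(?w - ?v) \<bullet> u \<le> 0" using s by (simp add: mult_le_0_iff)
  moreover have "u - ?v = s *\<^sub>R u" by (simp add: algebra_simps)
  ultimately have "(?w - ?v) \<bullet> (u - ?v) / \<beta> \<le> 0"
    using s \<beta> by (simp add: divide_le_0_iff mult_le_0_iff)
  then have "penalty \<beta> (p y) u \<le> penalty \<beta> (p y) ?v"
    using penalty_le_tangent_multiplier[OF \<beta>, of "p y" u ?v] by (simp add: updated_def)
  then have "objective ?v y \<le> objective u y" by (simp add: objective_def)
  also have "\<dots> \<le> val u" using max by (auto simp: maximizes_def intro: objective_le_val)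
  finally show ?thesis using val_eq[OF max] by simp
qed

end

section \<open>Smooth and nonsmooth ingredients of the minimax problem\<close>

text \<open>Only concavity along the segment from \<open>x\<close> to \<open>y\<close> is assumed; \<open>m\<close> is zero for plain concavity.\<close>
lemma below_tangent_of_strongly_concave:
  fixes f :: "'a::real_normed_vector \<Rightarrow> real"
  assumes der: "(f has_derivative f') (at x)"
    and m: "\<And>s. 0 < s \<Longrightarrow> s < 1 \<Longrightarrow>
      (1 - s) * f x + s * f y + s * (1 - s) * m \<le> f ((1 - s) *\<^sub>R x + s *\<^sub>R y)"
  shows "f y + m \<le> f x + f' (y - x)"
proof -
  define \<phi> where "\<phi> s = f (x + s *\<^sub>R (y - x))" for s
  have "(\<phi> has_derivative (\<lambda>s. f' (s *\<^sub>R (y - x)))) (at 0)"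
    unfolding \<phi>_def
    by (rule has_derivative_compose[where g = f and f = "\<lambda>s. x + s *\<^sub>R (y - x)"])
       (auto intro!: derivative_eq_intros der)
  moreover have "f' (s *\<^sub>R (y - x)) = f' (y - x) * s" for s
    using linear_scale[OF has_derivative_linear[OF der]] by simp
  ultimately have "(\<phi> has_real_derivative f' (y - x)) (at 0)"
    by (simp add: has_field_derivative_def)
  then have "((\<lambda>s. (\<phi> s - \<phi> 0) / s) \<longlongrightarrow> f' (y - x)) (at 0)"
    by (simp add: has_field_derivative_iff)
  then have lim: "((\<lambda>s. (\<phi> s - \<phi> 0) / s) \<longlongrightarrow> f' (y - x)) (at_right 0)"
    using filterlim_at_split by blast
  have lim': "((\<lambda>s. f y - f x + (1 - s) * m) \<longlongrightarrow> f y - f x + m) (at_right 0)"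
    by (auto intro!: tendsto_eq_intros)
  have "f y - f x + (1 - s) * m \<le> (\<phi> s - \<phi> 0) / s" if s: "0 < s" "s < 1" for s
  proof -
    have "x + s *\<^sub>R (y - x) = (1 - s) *\<^sub>R x + s *\<^sub>R y" by (simp add: algebra_simps)
    then have "(f y - f x + (1 - s) * m) * s \<le> \<phi> s - \<phi> 0"
      using m[OF s] by (simp add: \<phi>_def algebra_simps)
    then show ?thesis using s by (simp add: pos_le_divide_eq)
  qed
  then have "\<forall>\<^sub>F s in at_right 0. f y - f x + (1 - s) * m \<le> (\<phi> s - \<phi> 0) / s"
    unfolding eventually_at_right_field by (intro exI[of _ 1]) auto
  from tendsto_le[OF _ lim lim' this] show ?thesis by simp
qed

lemma convex_above_tangent:
  fixes f :: "'a::real_normed_vector \<Rightarrow> real"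
  assumes der: "(f has_derivative f') (at x)" and "convex_on UNIV f"
  shows "f x + f' (y - x) \<le> f y"
proof -
  have "((\<lambda>x. - f x) has_derivative (\<lambda>h. - f' h)) (at x)" using der by (rule has_derivative_minus)
  moreover have "(1 - s) * - f x + s * - f y + s * (1 - s) * 0 \<le> - f ((1 - s) *\<^sub>R x + s *\<^sub>R y)"
    if "0 < s" "s < 1" for s
  proof -
    have "f ((1 - s) *\<^sub>R x + s *\<^sub>R y) \<le> (1 - s) * f x + s * f y"
      using assms(2) that by (simp add: convex_on_def)
    then show ?thesis by simp
  qed
  ultimately have "- f y + 0 \<le> - f x + - f' (y - x)"
    by (rule below_tangent_of_strongly_concave)
  then show ?thesis by simp
qed

lemma gradient_eqI:
  assumes "(f has_derivative (\<lambda>h. h \<bullet> D)) (at x)" shows "gradient f x = D"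
  unfolding gradient_def
proof (rule the_equality)
  show "GDERIV f x :> D" using assms by (simp add: gderiv_def)
  fix D' assume "GDERIV f x :> D'"
  then have "(\<lambda>h. h \<bullet> D') = (\<lambda>h. h \<bullet> D)"
    using assms by (auto simp: gderiv_def intro: has_derivative_unique)
  then show "D' = D" by (metis inner_eq_zero_iff inner_diff_right right_minus_eq)
qed

lemma has_derivative_gradient:
  fixes f :: "'a::euclidean_space \<Rightarrow> real"
  assumes "f differentiable (at x)"
  shows "(f has_derivative (\<lambda>h. h \<bullet> gradient f x)) (at x)"
proof -
  obtain f' where der: "(f has_derivative f') (at x)" using assms by (auto simp: differentiable_def)
  have "f' h = h \<bullet> adjoint f' 1" for h
    using adjoint_works[OF has_derivative_linear[OF der], of h 1] by simp
  then have "f' = (\<lambda>h. h \<bullet> adjoint f' 1)" by blast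
  then show ?thesis using der gradient_eqI by metis
qed

text \<open>The distance is an infimum that may fail to be attained, and is infinite for the empty set.\<close>
lemma dist0_le_obtains:
  assumes "dist0 S \<le> ereal e" and "\<delta> > 0"
  obtains v where "v \<in> S" "norm v < e + \<delta>"
proof -
  have "dist0 S < ereal (e + \<delta>)" using assms by (meson ereal_less_eq(3) le_less_trans less_add_same_cancel1 less_ereal.simps(1))
  then show thesis using that unfolding dist0_def INF_less_iff by auto
qed

lemma abs_diff_le_cSUP_compact:
  fixes f :: "'a::metric_space \<Rightarrow> real"
  assumes "compact S" "continuous_on S f" "x \<in> S" "y \<in> S"
  shows "\<bar>f x - f y\<bar> \<le> (SUP (x, y)\<in>S \<times> S. \<bar>f x - f y\<bar>)"
proof -
  have "bounded (f ` S)" using assms by (intro compact_imp_bounded compact_continuous_image)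
  then obtain B where B: "\<And>x. x \<in> S \<Longrightarrow> \<bar>f x\<bar> \<le> B" by (auto simp: bounded_iff)
  have "bdd_above ((\<lambda>(x, y). \<bar>f x - f y\<bar>) ` (S \<times> S))"
  proof (rule bdd_aboveI2[where M = "2 * B"])
    fix w assume "w \<in> S \<times> S"
    then obtain a b where "w = (a, b)" "a \<in> S" "b \<in> S" by auto
    then show "(case w of (x, y) \<Rightarrow> \<bar>f x - f y\<bar>) \<le> 2 * B" using B[of a] B[of b] by simp
  qed
  then have "(\<lambda>(x, y). \<bar>f x - f y\<bar>) (x, y) \<le> (SUP w\<in>S \<times> S. (\<lambda>(x, y). \<bar>f x - f y\<bar>) w)"
    using assms by (intro cSUP_upper) auto
  then show ?thesis by simp
qed

context
  fixes g :: "'a::euclidean_space \<Rightarrow> ereal"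
  assumes g: "nonsmooth_term g"
begin

lemma nonsmooth_ereal: "x \<in> edom g \<Longrightarrow> ereal (real_of_ereal (g x)) = g x"
  using g by (cases "g x") (auto simp: nonsmooth_term_def proper_closed_convex_def edom_def)

lemma nonsmooth_infinite: "x \<notin> edom g \<Longrightarrow> g x = \<infinity>"
  by (simp add: edom_def)

lemma nonsmooth_compact: "compact (edom g)"
  using g by (simp add: nonsmooth_term_def)

lemma nonsmooth_continuous: "continuous_on (edom g) (\<lambda>x. real_of_ereal (g x))"
  using g by (auto simp: nonsmooth_term_def intro: lipschitz_on_continuous_on)

lemma nonsmooth_convex: "convex_on (edom g) (\<lambda>x. real_of_ereal (g x))"
proof -
  have comb: "g (s *\<^sub>R x + t *\<^sub>R y) \<le> ereal (s * real_of_ereal (g x) + t * real_of_ereal (g y))"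
    if "x \<in> edom g" "y \<in> edom g" "0 \<le> s" "0 \<le> t" "s + t = 1" for x y s t
  proof -
    have "(x, real_of_ereal (g x)) \<in> ereal_epigraph g" "(y, real_of_ereal (g y)) \<in> ereal_epigraph g"
      using that nonsmooth_ereal by (auto simp: ereal_epigraph_def)
    moreover have "convex (ereal_epigraph g)"
      using g by (simp add: nonsmooth_term_def proper_closed_convex_def)
    ultimately have "s *\<^sub>R (x, real_of_ereal (g x)) + t *\<^sub>R (y, real_of_ereal (g y)) \<in> ereal_epigraph g"
      using that by (intro convexD) auto
    then show ?thesis by (simp add: ereal_epigraph_def)
  qed
  have dom: "s *\<^sub>R x + t *\<^sub>R y \<in> edom g"
    if "x \<in> edom g" "y \<in> edom g" "0 \<le> s" "0 \<le> t" "s + t = 1" for x y s t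
    unfolding edom_def using comb[OF that] by (cases "g (s *\<^sub>R x + t *\<^sub>R y)") auto
  show ?thesis
    unfolding convex_on_def convex_def
  proof (intro conjI ballI allI impI)
    fix x y and s t :: real
    assume st: "x \<in> edom g" "y \<in> edom g" "0 \<le> s" "0 \<le> t" "s + t = 1"
    show "s *\<^sub>R x + t *\<^sub>R y \<in> edom g" using dom[OF st] .
    have "ereal (real_of_ereal (g (s *\<^sub>R x + t *\<^sub>R y)))
        \<le> ereal (s * real_of_ereal (g x) + t * real_of_ereal (g y))"
      using comb[OF st] nonsmooth_ereal[OF dom[OF st]] by simp
    then show "real_of_ereal (g (s *\<^sub>R x + t *\<^sub>R y)) \<le> s * real_of_ereal (g x) + t * real_of_ereal (g y)"
      by simp
  qed
qed

lemma nonsmooth_diff_le_max_diff: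
  assumes "x \<in> edom g" "y \<in> edom g"
  shows "real_of_ereal (g x) - real_of_ereal (g y) \<le> max_diff g"
  using abs_diff_le_cSUP_compact[OF nonsmooth_compact nonsmooth_continuous assms]
  unfolding max_diff_def by linarith

lemma subdiff_real:
  assumes "v \<in> subdiff g x" "x \<in> edom g" "y \<in> edom g"
  shows "real_of_ereal (g x) + v \<bullet> (y - x) \<le> real_of_ereal (g y)"
proof -
  have "g x + ereal (v \<bullet> (y - x)) \<le> g y" using assms(1) by (simp add: subdiff_def)
  then have "ereal (real_of_ereal (g x)) + ereal (v \<bullet> (y - x)) \<le> ereal (real_of_ereal (g y))"
    using nonsmooth_ereal[OF assms(2)] nonsmooth_ereal[OF assms(3)] by simp
  then show ?thesis by simp
qed

end

context
  fixes L :: real and c :: "real ^ 'n \<Rightarrow> real ^ 'q"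
  assumes c: "smooth_convex_constraint L c"
begin

lemma constraint_convex: "convex S \<Longrightarrow> convex_on S (\<lambda>x. c x $ i)"
  using c convex_on_subset[of UNIV "\<lambda>x. c x $ i" S] by (auto simp: smooth_convex_constraint_def)

lemma constraint_has_derivative: "(c has_derivative (\<lambda>h. Jac c x *v h)) (at x)"
proof -
  have "((\<lambda>x. c x \<bullet> b) differentiable (at x))" if b: "b \<in> Basis" for b
  proof -
    obtain i where "b = axis i 1" using b unfolding Basis_vec_def by auto
    then show ?thesis using c by (simp add: smooth_convex_constraint_def inner_axis)
  qed
  then have "c differentiable (at x)" using differentiable_componentwise_within by blast
  then show ?thesis by (simp add: jacobian_works)
qed

lemma constraint_continuous: "continuous_on S c"
  using constraint_has_derivative has_derivative_continuous
  by (intro continuous_at_imp_continuous_on) blast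

lemma constraint_closed: "closed {x. c x \<le> 0}"
  unfolding less_eq_vec_def
  by (auto intro!: closed_Collect_all closed_Collect_le continuous_intros
      continuous_on_compose2[OF _ constraint_continuous])

lemma constraint_above_tangent:
  assumes "0 \<le> z"
  shows "z \<bullet> c x + (transpose (Jac c x) *v z) \<bullet> (y - x) \<le> z \<bullet> c y"
proof -
  have "(transpose (Jac c x) *v z) \<bullet> (y - x) = z \<bullet> (Jac c x *v (y - x))"
    by (simp add: dot_lmul_matrix transpose_matrix_vector)
  moreover have "z $ i * c x $ i + z $ i * (Jac c x *v (y - x)) $ i \<le> z $ i * c y $ i" for i
  proof -
    have "((\<lambda>x. c x $ i) has_derivative (\<lambda>h. (Jac c x *v h) $ i)) (at x)"
      using bounded_linear.has_derivative[OF bounded_linear_vec_nth constraint_has_derivative] .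
    then have "c x $ i + (Jac c x *v (y - x)) $ i \<le> c y $ i"
      by (rule convex_above_tangent) (simp add: constraint_convex)
    then show ?thesis using assms
      by (simp add: less_eq_vec_def distrib_left[symmetric] mult_left_mono)
  qed
  ultimately show ?thesis
    by (simp add: inner_vec_def sum.distrib[symmetric] sum_mono)
qed

text \<open>The supremum is over a bounded set because the Jacobian is Lipschitz continuous and the domain
bounded.\<close>
lemma constraint_onorm_le_max_Jac_opnorm:
  assumes "compact (edom h)" "x \<in> edom h"
  shows "onorm ((*v) (Jac c x)) \<le> max_Jac_opnorm h c"
  unfolding max_Jac_opnorm_def
proof (rule cSUP_upper[OF assms(2)])
  obtain B where B: "\<And>y. y \<in> edom h \<Longrightarrow> norm y \<le> B"
    using compact_imp_bounded[OF assms(1)] by (auto simp: bounded_iff)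
  let ?N = "norm (Jac c 0) + \<bar>L\<bar> * B"
  have "onorm ((*v) (Jac c y)) \<le> real CARD('q) * real CARD('n) * ?N" if "y \<in> edom h" for y
  proof (rule onorm_le_matrix_component)
    fix i j
    have "\<bar>Jac c y $ i $ j\<bar> \<le> norm (Jac c y)"
      by (meson component_le_norm_cart Finite_Cartesian_Product.norm_nth_le order_trans)
    also have "\<dots> \<le> norm (Jac c 0) + norm (Jac c y - Jac c 0)" by (rule norm_triangle_sub)
    also have "norm (Jac c y - Jac c 0) \<le> L * norm (y - 0)"
      using c unfolding smooth_convex_constraint_def by blast
    also have "\<dots> \<le> \<bar>L\<bar> * B" using B[OF that] by (intro mult_mono) auto
    finally show "\<bar>Jac c y $ i $ j\<bar> \<le> ?N" by simp
  qed
  then show "bdd_above ((\<lambda>y. onorm ((*v) (Jac c y))) ` edom h)" by (rule bdd_aboveI2)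
qed

lemma constraint_lipschitz:
  assumes "compact (edom h)" "convex (edom h)" "edom h \<noteq> {}"
  shows "(max_Jac_opnorm h c)-lipschitz_on (edom h) c"
proof (rule bounded_derivative_imp_lipschitz)
  show "(c has_derivative (\<lambda>v. Jac c x *v v)) (at x within edom h)" for x
    by (rule has_derivative_at_withinI[OF constraint_has_derivative])
  show "onorm (\<lambda>v. Jac c x *v v) \<le> max_Jac_opnorm h c" if "x \<in> edom h" for x
    by (rule constraint_onorm_le_max_Jac_opnorm[OF assms(1) that])
  obtain y where "y \<in> edom h" using assms(3) by blast
  moreover have "0 \<le> onorm ((*v) (Jac c y))" by (simp add: onorm_pos_le)
  ultimately show "0 \<le> max_Jac_opnorm h c"
    using constraint_onorm_le_max_Jac_opnorm[OF assms(1)] by (meson order_trans)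
qed (rule assms(2))

lemma max_norm_nonneg:
  assumes "compact (edom h)" "edom h \<noteq> {}"
  shows "0 \<le> max_norm h c"
proof -
  obtain y where y: "y \<in> edom h" using assms(2) by blast
  have "bounded (c ` edom h)"
    by (intro compact_imp_bounded compact_continuous_image constraint_continuous assms(1))
  then obtain B where "\<And>y. y \<in> edom h \<Longrightarrow> norm (c y) \<le> B" by (auto simp: bounded_iff)
  then have "bdd_above ((\<lambda>y. norm (c y)) ` edom h)" by (rule bdd_aboveI2)
  then have "norm (c y) \<le> max_norm h c" unfolding max_norm_def by (rule cSUP_upper[OF y])
  then show ?thesis using norm_ge_zero[of "c y"] by linarith
qed

end

context
  fixes L :: real and F :: "real ^ 'n \<Rightarrow> real ^ 'm \<Rightarrow> real"
  assumes F: "smooth_coupling L F"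
begin

abbreviation full_gradient :: "real ^ 'n \<Rightarrow> real ^ 'm \<Rightarrow> (real ^ 'n) \<times> (real ^ 'm)" where
  "full_gradient x y \<equiv> gradient (\<lambda>(x, y). F x y) (x, y)"

lemma coupling_has_derivative:
  "((\<lambda>(x, y). F x y) has_derivative (\<lambda>h. h \<bullet> full_gradient x y)) (at (x, y))"
  using F by (intro has_derivative_gradient) (simp add: smooth_coupling_def)

lemma coupling_has_derivative_fst:
  "((\<lambda>x. F x y) has_derivative (\<lambda>h. h \<bullet> fst (full_gradient x y))) (at x)"
proof -
  have "((\<lambda>x. (x, y)) has_derivative (\<lambda>h. (h, 0))) (at x)"
    by (intro has_derivative_Pair has_derivative_ident has_derivative_const)
  from has_derivative_compose[OF this coupling_has_derivative[of x y]] show ?thesis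
    by (simp add: inner_prod_def)
qed

lemma coupling_has_derivative_snd:
  "(F x has_derivative (\<lambda>h. h \<bullet> snd (full_gradient x y))) (at y)"
proof -
  have "((\<lambda>y. (x, y)) has_derivative (\<lambda>h. (0, h))) (at y)"
    by (intro has_derivative_Pair has_derivative_ident has_derivative_const)
  from has_derivative_compose[OF this coupling_has_derivative[of x y]] show ?thesis
    by (simp add: inner_prod_def)
qed

lemma coupling_derivative_fst: "((\<lambda>x. F x y) has_derivative (\<lambda>h. h \<bullet> gradient (\<lambda>x. F x y) x)) (at x)"
  unfolding gradient_eqI[OF coupling_has_derivative_fst] by (rule coupling_has_derivative_fst)

lemma coupling_derivative_snd: "(F x has_derivative (\<lambda>h. h \<bullet> gradient (F x) y)) (at y)"
  unfolding gradient_eqI[OF coupling_has_derivative_snd] by (rule coupling_has_derivative_snd)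

lemma coupling_gradient_lipschitz:
  "norm (gradient (\<lambda>x. F x y) x - gradient (\<lambda>x. F x y') x) \<le> L * norm (y - y')"
proof -
  have "norm (fst (full_gradient x y) - fst (full_gradient x y'))
      \<le> norm (full_gradient x y - full_gradient x y')"
    using norm_fst_le[of "fst (full_gradient x y - full_gradient x y')" "snd (full_gradient x y - full_gradient x y')"]
    unfolding prod.collapse by (simp only: fst_diff)
  also have "\<dots> \<le> L * dist (x, y) (x, y')"
    using lipschitz_onD[of L UNIV "gradient (\<lambda>(x, y). F x y)" "(x, y)" "(x, y')"] F
    unfolding smooth_coupling_def dist_norm by blast
  also have "dist (x, y) (x, y') = norm (y - y')" by (simp add: dist_Pair_Pair dist_norm)
  finally show ?thesis
    by (simp only: gradient_eqI[OF coupling_has_derivative_fst])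
qed

lemma coupling_continuous: "continuous_on S (\<lambda>(x, y). F x y)"
proof (intro continuous_at_imp_continuous_on ballI)
  show "isCont (\<lambda>(x, y). F x y) w" for w
    by (cases w) (simp add: has_derivative_continuous[OF coupling_has_derivative])
qed

lemma coupling_continuous_snd: "continuous_on S (F x)"
  by (intro continuous_at_imp_continuous_on ballI has_derivative_continuous[OF coupling_derivative_snd])

end

section \<open>Value functions of the minimax problem\<close>

locale minimax_problem =
  fixes F :: "real ^ 'n \<Rightarrow> real ^ 'm \<Rightarrow> real"
    and g :: "real ^ 'n \<Rightarrow> ereal" and h :: "real ^ 'm \<Rightarrow> ereal"
    and c :: "real ^ 'n \<Rightarrow> real ^ 'q" and p :: "real ^ 'm \<Rightarrow> real ^ 'r"
    and L\<^sub>F L\<^sub>c L\<^sub>p \<mu>\<^sub>F \<beta>\<^sub>y :: real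
    and x_feas :: "real ^ 'n" and y_feas :: "real ^ 'm" and c_feas p_feas :: real
  assumes F: "smooth_coupling L\<^sub>F F"
    and g: "nonsmooth_term g" and h: "nonsmooth_term h"
    and c: "smooth_convex_constraint L\<^sub>c c" and p: "smooth_convex_constraint L\<^sub>p p"
    and x_feas: "x_feas \<in> edom g" and y_feas: "y_feas \<in> edom h"
    and c_slater: "\<And>i. c x_feas $ i \<le> - c_feas" and c_feas: "c_feas > 0"
    and p_slater: "\<And>i. p y_feas $ i \<le> - p_feas" and p_feas: "p_feas > 0"
    and \<mu>\<^sub>F: "\<mu>\<^sub>F > 0" and strong: "\<And>x. x \<in> edom g \<Longrightarrow> strongly_concave_on UNIV \<mu>\<^sub>F (F x)"
    and \<beta>\<^sub>y: "\<beta>\<^sub>y > 0"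
begin

abbreviation "gr x \<equiv> real_of_ereal (g x)"
abbreviation "hr y \<equiv> real_of_ereal (h y)"
abbreviation "M\<^sub>p \<equiv> max_Jac_opnorm h p"
abbreviation "\<Delta>\<^sub>y \<equiv> Delta_F F g h + max_diff h"

lemma convex_dom_h: "convex (edom h)"
  using nonsmooth_convex[OF h] by (simp add: convex_on_def)

lemma p_lipschitz: "M\<^sub>p-lipschitz_on (edom h) p"
  using y_feas by (intro constraint_lipschitz[OF p] nonsmooth_compact[OF h] convex_dom_h) auto

lemma inner_objective_concave: "concave_on (edom h) (\<lambda>y. F x y - hr y)"
proof -
  have "convex_on UNIV (\<lambda>y. - F x y)" using F by (simp add: smooth_coupling_def concave_on_def)
  then have "convex_on (edom h) (\<lambda>y. - F x y)"
    by (rule convex_on_subset) (auto simp: convex_dom_h)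
  from convex_on_add[OF this nonsmooth_convex[OF h]] show ?thesis by (simp add: concave_on_def)
qed

sublocale inner: penalised_program "edom h" "\<lambda>y. F x y - hr y" p "M\<^sub>p" p_feas \<beta>\<^sub>y y_feas for x
proof
  show "continuous_on (edom h) (\<lambda>y. F x y - hr y)"
    by (intro continuous_on_diff coupling_continuous_snd[OF F] nonsmooth_continuous[OF h])
qed (auto simp: nonsmooth_compact[OF h] inner_objective_concave p_lipschitz p_slater p_feas y_feas
      constraint_convex[OF p convex_dom_h] \<beta>\<^sub>y)

lemma Q_fun_eq:
  "Q_fun F h p \<beta>\<^sub>y x y u = (if y \<in> edom h then ereal (inner.objective x u y) else - \<infinity>)"
proof (cases "y \<in> edom h")
  case True
  have "Q_fun F h p \<beta>\<^sub>y x y u = ereal (F x y) - ereal (hr y) - ereal (penalty \<beta>\<^sub>y (p y) u)"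
    unfolding Q_fun_def penalty_def nonsmooth_ereal[OF h True] ..
  then show ?thesis using True by (simp add: inner.objective_def)
next
  case False
  then show ?thesis by (simp add: Q_fun_def nonsmooth_infinite[OF h])
qed

lemma Psi_eq: "Psi F h p \<beta>\<^sub>y x u = ereal (inner.val x u)"
proof -
  obtain y where y: "inner.maximizes x y u" by (rule inner.maximizer_exists)
  show ?thesis
    unfolding Psi_def
  proof (rule antisym)
    show "(SUP y. Q_fun F h p \<beta>\<^sub>y x y u) \<le> ereal (inner.val x u)"
      by (rule SUP_least) (simp add: Q_fun_eq inner.objective_le_val)
    have "ereal (inner.val x u) = Q_fun F h p \<beta>\<^sub>y x y u"
      using inner.val_eq[OF y] y by (simp add: Q_fun_eq inner.maximizes_def)
    then show "ereal (inner.val x u) \<le> (SUP y. Q_fun F h p \<beta>\<^sub>y x y u)"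
      by (metis SUP_upper UNIV_I)
  qed
qed

definition zeta_real :: "real ^ 'n \<Rightarrow> real" where
  "zeta_real x = real_of_ereal (zeta F h p x)"

text \<open>The feasible set of the inner problem within the domain of \<open>h\<close> is compact and contains the Slater
point, so \<open>\<zeta>\<close> is finite for every \<open>x\<close>; outside that domain the inner objective is \<open>- \<infinity>\<close>.\<close>
lemma zeta_attained:
  obtains y where "y \<in> edom h" "p y \<le> 0" "zeta F h p x = ereal (zeta_real x)" "zeta_real x = F x y - hr y"
    "\<And>y'. y' \<in> edom h \<Longrightarrow> p y' \<le> 0 \<Longrightarrow> F x y' - hr y' \<le> zeta_real x"
proof -
  have "compact (edom h \<inter> {y. p y \<le> 0})"
    using nonsmooth_compact[OF h] constraint_closed[OF p] by (rule compact_Int_closed)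
  moreover have "p y_feas \<le> 0"
    unfolding less_eq_vec_def using p_slater p_feas by (auto intro: order_trans[of _ "- p_feas"])
  then have "edom h \<inter> {y. p y \<le> 0} \<noteq> {}" using y_feas by blast
  moreover have "continuous_on (edom h \<inter> {y. p y \<le> 0}) (\<lambda>y. F x y - hr y)"
    using inner.continuous by (rule continuous_on_subset) auto
  ultimately obtain y where y: "y \<in> edom h" "p y \<le> 0"
    and max: "\<And>y'. y' \<in> edom h \<Longrightarrow> p y' \<le> 0 \<Longrightarrow> F x y' - hr y' \<le> F x y - hr y"
    using continuous_attains_sup[of "edom h \<inter> {y. p y \<le> 0}" "\<lambda>y. F x y - hr y"] by auto
  have val: "ereal (F x y) - h y = ereal (F x y - hr y)" if "y \<in> edom h" for y
  proof -
    have "ereal (F x y) - ereal (hr y) = ereal (F x y - hr y)" by simp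
    then show ?thesis unfolding nonsmooth_ereal[OF h that] .
  qed
  have "zeta F h p x = ereal (F x y - hr y)"
    unfolding zeta_def
  proof (rule antisym)
    show "(SUP y\<in>{y. p y \<le> 0}. ereal (F x y) - h y) \<le> ereal (F x y - hr y)"
    proof (rule SUP_least)
      fix y' assume "y' \<in> {y. p y \<le> 0}"
      then show "ereal (F x y') - h y' \<le> ereal (F x y - hr y)"
        using max[of y'] val[of y'] nonsmooth_infinite[OF h, of y'] by (cases "y' \<in> edom h") auto
    qed
    show "ereal (F x y - hr y) \<le> (SUP y\<in>{y. p y \<le> 0}. ereal (F x y) - h y)"
      unfolding val[OF y(1), symmetric] using y by (intro SUP_upper) auto
  qed
  then show thesis using that[of y] y max by (simp add: zeta_real_def)
qed

lemma zeta_eq: "zeta F h p x = ereal (zeta_real x)"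
  by (metis zeta_attained)

lemma le_zeta_real: "y \<in> edom h \<Longrightarrow> p y \<le> 0 \<Longrightarrow> F x y - hr y \<le> zeta_real x"
  by (metis zeta_attained)

text \<open>A pointwise maximum of functions convex in \<open>x\<close>. As \<open>\<zeta>\<close> is finite on the whole space, it is then
continuous as well, which the existence of a primal solution needs.\<close>
lemma zeta_real_convex: "convex_on UNIV zeta_real"
  unfolding convex_on_def
proof (intro conjI ballI allI impI)
  fix x x' :: "real ^ 'n" and s t :: real
  assume st: "0 \<le> s" "0 \<le> t" "s + t = 1"
  obtain y where y: "y \<in> edom h" "p y \<le> 0"
    "zeta_real (s *\<^sub>R x + t *\<^sub>R x') = F (s *\<^sub>R x + t *\<^sub>R x') y - hr y"
    by (metis zeta_attained)
  have "convex_on UNIV (\<lambda>x. F x y)" using F by (simp add: smooth_coupling_def)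
  then have "F (s *\<^sub>R x + t *\<^sub>R x') y \<le> s * F x y + t * F x' y"
    using st by (simp add: convex_on_def)
  moreover have "s * hr y + t * hr y = hr y" using st by (simp flip: distrib_right)
  ultimately have "zeta_real (s *\<^sub>R x + t *\<^sub>R x') \<le> s * (F x y - hr y) + t * (F x' y - hr y)"
    using y by (simp add: right_diff_distrib)
  also have "\<dots> \<le> s * zeta_real x + t * zeta_real x'"
    using st le_zeta_real[OF y(1,2)] by (intro add_mono mult_left_mono) auto
  finally show "zeta_real (s *\<^sub>R x + t *\<^sub>R x') \<le> s * zeta_real x + t * zeta_real x'" .
qed simp

lemma primal_minimizer_exists:
  obtains xs where "xs \<in> edom g" "c xs \<le> 0"
    "\<And>x. x \<in> edom g \<Longrightarrow> c x \<le> 0 \<Longrightarrow> zeta_real xs + gr xs \<le> zeta_real x + gr x"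
    "is_arg_min (\<lambda>x. zeta F h p x + g x) (\<lambda>x. c x \<le> 0) xs"
proof -
  let ?X = "edom g \<inter> {x. c x \<le> 0}"
  have "compact ?X"
    using nonsmooth_compact[OF g] constraint_closed[OF c] by (rule compact_Int_closed)
  moreover have "c x_feas \<le> 0"
    unfolding less_eq_vec_def using c_slater c_feas by (auto intro: order_trans[of _ "- c_feas"])
  then have "?X \<noteq> {}" using x_feas by blast
  moreover have "continuous_on ?X (\<lambda>x. zeta_real x + gr x)"
    using convex_on_continuous[OF open_UNIV zeta_real_convex] nonsmooth_continuous[OF g]
    by (intro continuous_on_add) (auto elim: continuous_on_subset)
  ultimately obtain xs where xs: "xs \<in> edom g" "c xs \<le> 0"
    and min: "\<And>x. x \<in> edom g \<Longrightarrow> c x \<le> 0 \<Longrightarrow> zeta_real xs + gr xs \<le> zeta_real x + gr x"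
    using continuous_attains_inf[of ?X "\<lambda>x. zeta_real x + gr x"] by auto
  have "\<not> zeta F h p x + g x < zeta F h p xs + g xs" if "c x \<le> 0" for x
  proof (cases "x \<in> edom g")
    case True
    have "ereal (zeta_real xs) + ereal (gr xs) \<le> ereal (zeta_real x) + ereal (gr x)"
      using min[OF True that] by simp
    then show ?thesis
      unfolding nonsmooth_ereal[OF g True] nonsmooth_ereal[OF g xs(1)] zeta_eq by (simp add: not_less)
  next
    case False
    then show ?thesis by (simp add: zeta_eq nonsmooth_infinite[OF g])
  qed
  then have "is_arg_min (\<lambda>x. zeta F h p x + g x) (\<lambda>x. c x \<le> 0) xs"
    using xs by (simp add: is_arg_min_def)
  then show thesis using that xs min by blast
qed

lemma F_bounded:
  obtains B where "\<And>x y. x \<in> edom g \<Longrightarrow> y \<in> edom h \<Longrightarrow> \<bar>F x y\<bar> \<le> B"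
proof -
  have "bounded ((\<lambda>(x, y). F x y) ` (edom g \<times> edom h))"
    by (intro compact_imp_bounded compact_continuous_image coupling_continuous[OF F] compact_Times
        nonsmooth_compact[OF g] nonsmooth_compact[OF h])
  then show thesis using that by (fastforce simp: bounded_iff)
qed

lemma F_diff_le_Delta_F:
  assumes "x \<in> edom g" "y \<in> edom h" "y' \<in> edom h"
  shows "F x y - F x y' \<le> Delta_F F g h"
proof -
  obtain B where B: "\<And>x y. x \<in> edom g \<Longrightarrow> y \<in> edom h \<Longrightarrow> \<bar>F x y\<bar> \<le> B"
    using F_bounded by blast
  have "bdd_above ((\<lambda>(x, y, y'). \<bar>F x y - F x y'\<bar>) ` (edom g \<times> edom h \<times> edom h))"
  proof (rule bdd_aboveI2[where M = "2 * B"])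
    fix w assume "w \<in> edom g \<times> edom h \<times> edom h"
    then obtain x y y' where "w = (x, y, y')" "x \<in> edom g" "y \<in> edom h" "y' \<in> edom h" by auto
    then show "(case w of (x, y, y') \<Rightarrow> \<bar>F x y - F x y'\<bar>) \<le> 2 * B"
      using B[of x y] B[of x y'] by simp
  qed
  then have "(\<lambda>(x, y, y'). \<bar>F x y - F x y'\<bar>) (x, y, y') \<le> Delta_F F g h"
    unfolding Delta_F_def using assms by (intro cSUP_upper) auto
  then show ?thesis by simp
qed

lemma inner_objective_range:
  assumes "x \<in> edom g" "y \<in> edom h" "y' \<in> edom h"
  shows "(F x y - hr y) - (F x y' - hr y') \<le> \<Delta>\<^sub>y"
  using F_diff_le_Delta_F[OF assms] nonsmooth_diff_le_max_diff[OF h assms(3,2)] by simp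

lemma \<Delta>\<^sub>y_nonneg: "0 \<le> \<Delta>\<^sub>y"
  using inner_objective_range[OF x_feas y_feas y_feas] by simp

lemma val_diff_le_Delta_Psi:
  assumes "x \<in> edom g" "x' \<in> edom g" "norm u \<le> D"
  shows "inner.val x u - inner.val x' u \<le> Delta_Psi F g h p \<beta>\<^sub>y D"
proof -
  obtain B where B: "\<And>x y. x \<in> edom g \<Longrightarrow> y \<in> edom h \<Longrightarrow> \<bar>F x y\<bar> \<le> B"
    using F_bounded by blast
  have le: "inner.val x u - inner.val x' u \<le> 2 * B" if "x \<in> edom g" "x' \<in> edom g" for x x' u
  proof -
    obtain y where y: "inner.maximizes x y u" by (rule inner.maximizer_exists)
    then have dom: "y \<in> edom h" by (simp add: inner.maximizes_def)
    have "inner.objective x u y - inner.objective x' u y = F x y - F x' y"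
      by (simp add: inner.objective_def)
    then show ?thesis
      using inner.val_eq[OF y] inner.objective_le_val[OF dom, of x' u] B[OF that(1) dom] B[OF that(2) dom]
      by linarith
  qed
  have "bdd_above ((\<lambda>(x, x', u). \<bar>real_of_ereal (Psi F h p \<beta>\<^sub>y x u) - real_of_ereal (Psi F h p \<beta>\<^sub>y x' u)\<bar>)
      ` (edom g \<times> edom g \<times> {u. norm u \<le> D}))"
  proof (rule bdd_aboveI2[where M = "2 * B"])
    fix w :: "(real ^ 'n) \<times> (real ^ 'n) \<times> (real ^ 'r)"
    assume "w \<in> edom g \<times> edom g \<times> {u. norm u \<le> D}"
    then obtain x x' u where "w = (x, x', u)" "x \<in> edom g" "x' \<in> edom g" by auto
    then show "(case w of (x, x', u) \<Rightarrow>
        \<bar>real_of_ereal (Psi F h p \<beta>\<^sub>y x u) - real_of_ereal (Psi F h p \<beta>\<^sub>y x' u)\<bar>) \<le> 2 * B"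
      using le[of x x' u] le[of x' x u] by (simp add: Psi_eq abs_le_iff)
  qed
  then have "(\<lambda>(x, x', u). \<bar>real_of_ereal (Psi F h p \<beta>\<^sub>y x u) - real_of_ereal (Psi F h p \<beta>\<^sub>y x' u)\<bar>) (x, x', u)
      \<le> Delta_Psi F g h p \<beta>\<^sub>y D"
    unfolding Delta_Psi_def using assms by (intro cSUP_upper) auto
  then show ?thesis by (simp add: Psi_eq)
qed

text \<open>The bound on the norm does not depend on \<open>x\<close>, because \<open>\<Delta>\<^sub>y\<close> bounds the range of all inner
objectives \<open>\<lambda>y. F x y - hr y\<close>.\<close>
lemma inner_multiplier:
  assumes x: "x \<in> edom g"
  obtains u where "0 \<le> u" "norm u \<le> \<Delta>\<^sub>y / p_feas"
    "\<And>y. y \<in> edom h \<Longrightarrow> F x y - hr y - u \<bullet> p y \<le> zeta_real x"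
proof -
  obtain u where u: "0 \<le> u" and dual: "\<And>y. y \<in> edom h \<Longrightarrow> F x y - hr y - u \<bullet> p y \<le> zeta_real x"
    and le: "p_feas * norm u \<le> zeta_real x - (F x y_feas - hr y_feas)"
    using slater_multiplier[OF inner_objective_concave inner.convex y_feas p_feas p_slater le_zeta_real] by blast
  obtain y where y: "y \<in> edom h" "zeta_real x = F x y - hr y" by (metis zeta_attained)
  have "p_feas * norm u \<le> \<Delta>\<^sub>y" using le inner_objective_range[OF x y(1) y_feas] y(2) by simp
  then have "norm u \<le> \<Delta>\<^sub>y / p_feas" using p_feas by (simp add: field_simps)
  then show thesis using that u dual by blast
qed

text \<open>At feasible points the penalty is nonpositive, for every multiplier.\<close>
lemma zeta_real_le_val: "zeta_real x \<le> inner.val x u"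
proof -
  obtain y where y: "y \<in> edom h" "p y \<le> 0" "zeta_real x = F x y - hr y" by (metis zeta_attained)
  have "zeta_real x \<le> inner.objective x u y"
    using penalty_nonpos[OF \<beta>\<^sub>y y(2)] y(3) by (simp add: inner.objective_def)
  also have "\<dots> \<le> inner.val x u" by (rule inner.objective_le_val[OF y(1)])
  finally show ?thesis .
qed

text \<open>For an optimal inner multiplier \<open>u\<close> of \<open>x'\<close> the values \<open>\<zeta> x'\<close> and \<open>\<Psi> x' u\<close> agree, while \<open>\<zeta> x\<close> is
at most \<open>\<Psi> x u\<close>.\<close>
lemma zeta_real_diff_le_Delta_Psi:
  assumes x: "x \<in> edom g" and x': "x' \<in> edom g" and D: "\<Delta>\<^sub>y / p_feas \<le> D"
  shows "zeta_real x - zeta_real x' \<le> Delta_Psi F g h p \<beta>\<^sub>y D"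
proof -
  obtain u where u: "0 \<le> u" "norm u \<le> \<Delta>\<^sub>y / p_feas"
    and dual: "\<And>y. y \<in> edom h \<Longrightarrow> F x' y - hr y - u \<bullet> p y \<le> zeta_real x'"
    using inner_multiplier[OF x'] by blast
  obtain y where y: "inner.maximizes x' y u" by (rule inner.maximizer_exists)
  have "inner.val x' u \<le> zeta_real x'"
    using inner.val_eq[OF y] dual[of y] y penalty_ge_linear[OF \<beta>\<^sub>y u(1), of "p y"]
    by (simp add: inner.objective_def inner.maximizes_def)
  moreover have "inner.val x u - inner.val x' u \<le> Delta_Psi F g h p \<beta>\<^sub>y D"
    using u D by (intro val_diff_le_Delta_Psi x x') auto
  ultimately show ?thesis using zeta_real_le_val[of x u] by linarith
qed

end

section \<open>Boundedness of the multipliers\<close>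

lemma sum_power_le_geometric:
  assumes "0 \<le> (q :: real)" "q < 1" shows "(\<Sum>k<n. q ^ k) \<le> 1 / (1 - q)"
  using sum_gp_strict[of q n] assms by (simp add: divide_right_mono)

context minimax_problem
begin

text \<open>If \<open>u\<close> violated the bound, moving it to \<open>(1 - s) *\<^sub>R u\<close> for small \<open>s\<close> would not increase \<open>\<Psi>\<close>, so the
subgradient inequality would involve only the proximal term. To first order in \<open>s\<close> it reads
\<open>\<rho> * (u \<bullet> (u - ut)) \<le> snd r \<bullet> u\<close>, which limits \<open>norm u\<close> to \<open>norm ut + norm r / \<rho>\<close>.\<close>
lemma prox_step_multiplier_bound:
  assumes x: "x \<in> edom g" and \<rho>: "\<rho> > 0" and \<eta>: "\<eta> \<ge> 0"
    and approx: "dist0 (subdiff (\<lambda>(x, u). vartheta F g h c p \<beta>\<^sub>y xt ut x u zt \<beta> \<rho>) (x, u)) \<le> ereal \<eta>"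
  shows "norm u \<le> max (\<Delta>\<^sub>y / p_feas) (norm ut + \<eta> / \<rho>)"
proof (rule ccontr)
  assume "\<not> ?thesis"
  then have big: "\<Delta>\<^sub>y / p_feas < norm u" "norm ut + \<eta> / \<rho> < norm u" by auto
  have "0 \<le> \<Delta>\<^sub>y / p_feas" using \<Delta>\<^sub>y_nonneg p_feas by (rule divide_nonneg_pos)
  then have nu: "norm u > 0" using big(1) by linarith
  \<comment> \<open>For \<open>s < s0\<close> the shrunken multiplier is still longer than \<open>\<Delta>\<^sub>y / p_feas\<close>.\<close>
  define s0 where "s0 = 1 - \<Delta>\<^sub>y / p_feas / norm u"
  have "\<Delta>\<^sub>y / p_feas / norm u < 1" using big(1) by (simp only: pos_divide_less_eq[OF nu] mult_1)
  then have s0: "0 < s0" "s0 \<le> 1" using \<Delta>\<^sub>y_nonneg p_feas by (simp_all add: s0_def)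
  \<comment> \<open>The assumed excess; a subgradient of norm less than \<open>\<eta> + \<delta>\<close> already gives a contradiction.\<close>
  define \<delta> where "\<delta> = (norm u - norm ut - \<eta> / \<rho>) * \<rho>"
  have \<delta>: "\<delta> > 0" using big(2) \<rho> by (simp add: \<delta>_def)
  obtain r where r: "r \<in> subdiff (\<lambda>(x, u). vartheta F g h c p \<beta>\<^sub>y xt ut x u zt \<beta> \<rho>) (x, u)"
    and nr: "norm r < \<eta> + \<delta>" using dist0_le_obtains[OF approx \<delta>] by blast
  \<comment> \<open>The terms of the proximal augmented Lagrangian other than \<open>\<Psi>\<close> and \<open>g\<close>.\<close>
  define A where "A v = 1 / (2 * \<beta>) * (norm (pos_part (\<beta> *\<^sub>R c x + zt)))\<^sup>2 - 1 / (2 * \<beta>) * (norm zt)\<^sup>2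
      + \<rho> / 2 * ((norm (x - xt))\<^sup>2 + (norm (v - ut))\<^sup>2)" for v
  have vartheta_eq: "vartheta F g h c p \<beta>\<^sub>y xt ut x v zt \<beta> \<rho> = ereal (inner.val x v + gr x + A v)" for v
  proof -
    have "vartheta F g h c p \<beta>\<^sub>y xt ut x v zt \<beta> \<rho> = ereal (inner.val x v) + ereal (gr x) + ereal (A v)"
      unfolding vartheta_def Psi_eq A_def nonsmooth_ereal[OF g x] ..
    then show ?thesis by simp
  qed
  have le: "\<rho> * (u \<bullet> (u - ut)) - snd r \<bullet> u \<le> s * (\<rho> * (norm u)\<^sup>2 / 2)" if s: "0 < s" "s < s0" for s
  proof -
    let ?v = "(1 - s) *\<^sub>R u"
    have "ereal (inner.val x u + gr x + A u) + ereal (r \<bullet> ((x, ?v) - (x, u)))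
        \<le> ereal (inner.val x ?v + gr x + A ?v)"
      using r unfolding subdiff_def by (auto simp: vartheta_eq dest: spec[of _ x])
    then have "inner.val x u + A u + snd r \<bullet> (?v - u) \<le> inner.val x ?v + A ?v"
      by (simp add: inner_prod_def)
    moreover have "\<Delta>\<^sub>y / p_feas / norm u \<le> 1 - s" using s by (simp add: s0_def)
    then have "\<Delta>\<^sub>y / p_feas \<le> (1 - s) * norm u" by (simp only: pos_divide_le_eq[OF nu])
    then have "inner.val x ?v \<le> inner.val x u"
      using s s0 by (intro inner.val_shrink_le[OF inner_objective_range[OF x _ y_feas]]) auto
    moreover have "?v - u = - s *\<^sub>R u" by (simp add: algebra_simps)
    then have "snd r \<bullet> (?v - u) = - s * (snd r \<bullet> u)" by simp
    moreover have "?v - ut = (u - ut) - s *\<^sub>R u" by (simp add: algebra_simps)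
    then have eq: "(norm (?v - ut))\<^sup>2 = (norm (u - ut))\<^sup>2 - 2 * s * (u \<bullet> (u - ut)) + s\<^sup>2 * (norm u)\<^sup>2"
      by (simp only: power2_norm_eq_inner inner_diff_left inner_diff_right)
         (simp add: algebra_simps power2_eq_square inner_commute)
    moreover have "A ?v = A u + \<rho> / 2 * (- 2 * s * (u \<bullet> (u - ut)) + s\<^sup>2 * (norm u)\<^sup>2)"
      unfolding A_def eq by (simp add: algebra_simps)
    ultimately have "s * (\<rho> * (u \<bullet> (u - ut)) - snd r \<bullet> u) \<le> s * (s * (\<rho> * (norm u)\<^sup>2 / 2))"
      by (simp add: algebra_simps power2_eq_square)
    then show ?thesis using s by simp
  qed
  have "\<rho> * (u \<bullet> (u - ut)) - snd r \<bullet> u \<le> s * (s0 * (\<rho> * (norm u)\<^sup>2 / 2))" if "0 < s" "s < 1" for s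
  proof -
    have "0 < s * s0" "s * s0 < s0" using that s0 by simp_all
    then show ?thesis using le[of "s * s0"] by (simp add: mult.assoc)
  qed
  then have "\<rho> * (u \<bullet> (u - ut)) - snd r \<bullet> u \<le> 0" by (rule nonpos_if_le_small_multiples)
  then have "\<rho> * (u \<bullet> (u - ut)) \<le> norm (snd r) * norm u"
    using norm_cauchy_schwarz[of "snd r" u] by linarith
  also have "\<dots> < (\<eta> + \<delta>) * norm u"
    using nu nr norm_snd_le[of "snd r" "fst r"] by (intro mult_strict_right_mono) auto
  also have "\<dots> = \<rho> * (norm u * (norm u - norm ut))" using \<rho> by (simp add: \<delta>_def field_simps)
  also have "norm u * (norm u - norm ut) \<le> u \<bullet> (u - ut)"
    using norm_cauchy_schwarz[of u ut] by (simp add: inner_diff_right right_diff_distrib power2_norm_eq_inner[symmetric] power2_eq_square)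
  finally show False using \<rho> by simp
qed

section \<open>The primal gap\<close>

text \<open>Strong concavity is used twice: at the exact maximizer \<open>y\<close>, and through the tangent bound at the
approximate one. The two gains of \<open>\<mu>\<^sub>F / 2 * (norm (y - y'))\<^sup>2\<close> add up and are paid for by the
residual times \<open>norm (y - y')\<close>.\<close>
lemma maximizer_distance:
  assumes x: "x \<in> edom g" and max: "inner.maximizes x y u" and y': "y' \<in> edom h" and e: "e \<ge> 0"
    and approx: "dist0 {gradient (F x) y' - v - transpose (Jac p y') *v pos_part (\<beta>\<^sub>y *\<^sub>R p y' + u)
      | v. v \<in> subdiff h y'} \<le> ereal (e * \<mu>\<^sub>F)"
  shows "norm (y - y') \<le> e"
proof (rule ccontr)
  assume "\<not> norm (y - y') \<le> e"
  then have far: "e < norm (y - y')" by simp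
  define \<delta> where "\<delta> = (norm (y - y') - e) * \<mu>\<^sub>F"
  have \<delta>: "\<delta> > 0" using far \<mu>\<^sub>F by (simp add: \<delta>_def)
  have y: "y \<in> edom h" using max by (simp add: inner.maximizes_def)
  define m where "m = \<mu>\<^sub>F / 2 * (norm (y - y'))\<^sup>2"
  let ?u' = "pos_part (\<beta>\<^sub>y *\<^sub>R p y' + u)"
  obtain v where v: "v \<in> subdiff h y'"
    and w: "norm (gradient (F x) y' - v - transpose (Jac p y') *v ?u') < e * \<mu>\<^sub>F + \<delta>"
    using dist0_le_obtains[OF approx \<delta>] by blast
  have sc: "(1 - s) * F x a + s * F x b + \<mu>\<^sub>F / 2 * s * (1 - s) * (norm (a - b))\<^sup>2
      \<le> F x ((1 - s) *\<^sub>R a + s *\<^sub>R b)" if "0 < s" "s < 1" for a b s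
    using strong[OF x] that by (auto simp: strongly_concave_on_def)
  have "F x y + m \<le> F x y' + (y - y') \<bullet> gradient (F x) y'"
  proof (rule below_tangent_of_strongly_concave[OF coupling_derivative_snd[OF F]])
    fix s :: real assume "0 < s" "s < 1"
    then show "(1 - s) * F x y' + s * F x y + s * (1 - s) * m \<le> F x ((1 - s) *\<^sub>R y' + s *\<^sub>R y)"
      using sc[of s y' y] by (simp add: m_def norm_minus_commute algebra_simps)
  qed
  moreover have "hr y' + v \<bullet> (y - y') \<le> hr y" by (rule subdiff_real[OF h v y' y])
  moreover have "penalty \<beta>\<^sub>y (p y') u + ?u' \<bullet> (p y - p y') \<le> penalty \<beta>\<^sub>y (p y) u"
    by (rule penalty_ge_tangent[OF \<beta>\<^sub>y])
  moreover have "?u' \<bullet> p y' + (transpose (Jac p y') *v ?u') \<bullet> (y - y') \<le> ?u' \<bullet> p y"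
    by (rule constraint_above_tangent[OF p pos_part_nonneg])
  ultimately have 1: "inner.objective x u y + m \<le> inner.objective x u y'
      + (gradient (F x) y' - v - transpose (Jac p y') *v ?u') \<bullet> (y - y')"
    by (simp only: inner.objective_def inner_diff_left inner_diff_right inner_commute)
  have "F x y' - hr y' - inner.updated y u \<bullet> p y' + m \<le> F x y - hr y - inner.updated y u \<bullet> p y"
  proof (rule inner.maximizer_maximizes_Lagrangian[OF max y'])
    fix s :: real assume s: "0 < s" "s < 1"
    have "hr ((1 - s) *\<^sub>R y + s *\<^sub>R y') \<le> (1 - s) * hr y + s * hr y'"
      using nonsmooth_convex[OF h] s y y' by (auto simp: convex_on_def)
    then show "(1 - s) * (F x y - hr y) + s * (F x y' - hr y') + s * (1 - s) * m
        \<le> F x ((1 - s) *\<^sub>R y + s *\<^sub>R y') - hr ((1 - s) *\<^sub>R y + s *\<^sub>R y')"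
      using sc[OF s, of y y'] by (simp add: m_def algebra_simps)
  qed
  moreover have "penalty \<beta>\<^sub>y (p y) u + inner.updated y u \<bullet> (p y' - p y) \<le> penalty \<beta>\<^sub>y (p y') u"
    unfolding inner.updated_def by (rule penalty_ge_tangent[OF \<beta>\<^sub>y])
  ultimately have 2: "inner.objective x u y' + m \<le> inner.objective x u y"
    by (simp add: inner.objective_def inner_diff_right)
  have "2 * m \<le> (gradient (F x) y' - v - transpose (Jac p y') *v ?u') \<bullet> (y - y')"
    using 1 2 by linarith
  also have "\<dots> \<le> norm (gradient (F x) y' - v - transpose (Jac p y') *v ?u') * norm (y - y')"
    by (rule norm_cauchy_schwarz)
  also have "\<dots> < (e * \<mu>\<^sub>F + \<delta>) * norm (y - y')"
    using w far e by (intro mult_strict_right_mono) auto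
  also have "\<dots> = 2 * m" by (simp add: \<delta>_def m_def power2_eq_square algebra_simps)
  finally show False by simp
qed

text \<open>Convexity of the Lagrangian in \<open>x\<close>, with the gradient of \<open>F\<close> evaluated at \<open>y'\<close> instead of \<open>y\<close>. The
constant collects the complementarity error, the residual, and the gradient perturbation.\<close>
lemma primal_stationarity_bound:
  assumes x': "x' \<in> edom g" and x: "x \<in> edom g" "c x \<le> 0" and z: "0 \<le> z"
    and compl: "(\<Sum>i\<in>UNIV. \<bar>c x' $ i * z $ i\<bar>) \<le> \<epsilon>" and close: "norm (y - y') \<le> \<epsilon>"
    and stat: "dist0 {gradient (\<lambda>x. F x y') x' + v + transpose (Jac c x') *v z | v. v \<in> subdiff g x'}
      \<le> ereal \<epsilon>"
  shows "F x' y + gr x' \<le> F x y + gr x + (1 + diameter (edom g) * (1 + L\<^sub>F)) * \<epsilon>"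
proof (rule field_le_epsilon)
  fix e :: real assume e: "e > 0"
  define D where "D = diameter (edom g)"
  have "bounded (edom g)" using nonsmooth_compact[OF g] by (rule compact_imp_bounded)
  then have D: "norm (x - x') \<le> D" "0 \<le> D"
    using diameter_bounded_bound[of "edom g" x x'] x x' diameter_ge_0 by (auto simp: D_def dist_norm)
  have L: "0 \<le> L\<^sub>F" using F lipschitz_on_nonneg by (auto simp: smooth_coupling_def)
  define \<delta> where "\<delta> = e / (D + 1)"
  have \<delta>: "\<delta> > 0" "\<delta> * D \<le> e" using e D by (auto simp: \<delta>_def field_simps)
  obtain v where v: "v \<in> subdiff g x'"
    and w: "norm (gradient (\<lambda>x. F x y') x' + v + transpose (Jac c x') *v z) < \<epsilon> + \<delta>"
    using dist0_le_obtains[OF stat \<delta>(1)] by blast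
  define w where "w = gradient (\<lambda>x. F x y') x' + v + transpose (Jac c x') *v z"
  define k where "k = gradient (\<lambda>x. F x y) x' - gradient (\<lambda>x. F x y') x'"
  have "convex_on UNIV (\<lambda>x. F x y)" using F by (simp add: smooth_coupling_def)
  then have "F x' y + gradient (\<lambda>x. F x y) x' \<bullet> (x - x') \<le> F x y"
    using convex_above_tangent[OF coupling_derivative_fst[OF F]] by (simp only: inner_commute)
  moreover have "gr x' + v \<bullet> (x - x') \<le> gr x" by (rule subdiff_real[OF g v x' x(1)])
  moreover have "z \<bullet> c x' + (transpose (Jac c x') *v z) \<bullet> (x - x') \<le> z \<bullet> c x"
    by (rule constraint_above_tangent[OF c z])
  moreover have "z \<bullet> c x \<le> 0" by (rule inner_nonneg_nonpos[OF z x(2)])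
  moreover have "- (z \<bullet> c x') \<le> \<epsilon>"
  proof -
    have "- (z \<bullet> c x') \<le> (\<Sum>i\<in>UNIV. \<bar>c x' $ i * z $ i\<bar>)"
      unfolding inner_vec_def sum_negf[symmetric] by (intro sum_mono) (simp add: mult.commute)
    then show ?thesis using compl by simp
  qed
  ultimately have "F x' y + gr x' + w \<bullet> (x - x') + k \<bullet> (x - x') \<le> F x y + gr x + \<epsilon>"
    unfolding w_def k_def inner_add_left inner_diff_left by linarith
  moreover have "- (w \<bullet> (x - x')) \<le> (\<epsilon> + \<delta>) * D"
  proof -
    have "- (w \<bullet> (x - x')) \<le> norm w * norm (x - x')"
      using norm_cauchy_schwarz[of "- w" "x - x'"] by simp
    also have "\<dots> \<le> (\<epsilon> + \<delta>) * D"
      using w D unfolding w_def by (intro mult_mono) (auto intro: order_trans[OF norm_ge_zero less_imp_le])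
    finally show ?thesis .
  qed
  moreover have "- (k \<bullet> (x - x')) \<le> (L\<^sub>F * \<epsilon>) * D"
  proof -
    have "norm k \<le> L\<^sub>F * norm (y - y')" unfolding k_def by (rule coupling_gradient_lipschitz[OF F])
    also have "\<dots> \<le> L\<^sub>F * \<epsilon>" using close L by (rule mult_left_mono)
    finally have "norm k * norm (x - x') \<le> (L\<^sub>F * \<epsilon>) * D"
      using D by (intro mult_mono) (auto intro: order_trans[OF norm_ge_zero])
    then show ?thesis using norm_cauchy_schwarz[of "- k" "x - x'"] by simp
  qed
  ultimately show "F x' y + gr x' \<le> F x y + gr x + (1 + diameter (edom g) * (1 + L\<^sub>F)) * \<epsilon> + e"
    using \<delta>(2) unfolding D_def[symmetric] by (simp add: algebra_simps)
qed

text \<open>The maximizer \<open>y\<close> of the augmented Lagrangian at \<open>x'\<close> links the two sides. It serves as a maximizer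
of the Lagrangian at \<open>x'\<close> and as an almost feasible point at \<open>x\<close>.\<close>
lemma primal_gap_upper:
  assumes x': "x' \<in> edom g" and y': "y' \<in> edom h" and x: "x \<in> edom g" "c x \<le> 0" and \<epsilon>: "\<epsilon> > 0"
    and kkt: "eps_KKT_with F g h c p \<epsilon> x' y' z (pos_part (\<beta>\<^sub>y *\<^sub>R p y' + u))"
    and approx: "dist0 {gradient (F x') y' - v - transpose (Jac p y') *v pos_part (\<beta>\<^sub>y *\<^sub>R p y' + u)
      | v. v \<in> subdiff h y'} \<le> ereal (\<epsilon> * \<mu>\<^sub>F)"
  shows "zeta_real x' + gr x' \<le> zeta_real x + gr x + (\<Delta>\<^sub>y / p_feas + 2 + diameter (edom g) * (1 + L\<^sub>F)
    + (norm u + \<Delta>\<^sub>y / p_feas) * M\<^sub>p) * \<epsilon>"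
proof -
  define D where "D = \<Delta>\<^sub>y / p_feas"
  obtain y where max: "inner.maximizes x' y u" by (rule inner.maximizer_exists)
  have y: "y \<in> edom h" using max by (simp add: inner.maximizes_def)
  have close: "norm (y - y') \<le> \<epsilon>"
    using \<epsilon> by (intro maximizer_distance[OF x' max y' _ approx]) auto
  have M0: "0 \<le> M\<^sub>p" using p_lipschitz by (rule lipschitz_on_nonneg)
  have "norm (p y - p y') \<le> M\<^sub>p * norm (y - y')"
    using lipschitz_onD[OF p_lipschitz y y'] by (simp add: dist_norm)
  also have "\<dots> \<le> M\<^sub>p * \<epsilon>" using close M0 by (rule mult_left_mono)
  finally have pclose: "norm (p y - p y') \<le> M\<^sub>p * \<epsilon>" .
  let ?w = "inner.updated y u"
  have "zeta_real x' \<le> F x' y - hr y - ?w \<bullet> p y"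
  proof -
    obtain y0 where y0: "y0 \<in> edom h" "p y0 \<le> 0" "zeta_real x' = F x' y0 - hr y0" by (metis zeta_attained)
    have "?w \<bullet> p y0 \<le> 0"
      unfolding inner.updated_def by (rule inner_nonneg_nonpos[OF pos_part_nonneg y0(2)])
    then show ?thesis
      using inner.maximizer_maximizes_Lagrangian_weak[OF max y0(1)] y0(3) by simp
  qed
  moreover have "- (?w \<bullet> p y) \<le> \<epsilon> + norm u * (M\<^sub>p * \<epsilon>)"
  proof -
    have "- (?w \<bullet> p y) \<le> (\<Sum>i\<in>UNIV. \<bar>p y' $ i * pos_part (\<beta>\<^sub>y *\<^sub>R p y' + u) $ i\<bar>) + norm u * norm (p y - p y')"
      unfolding inner.updated_def by (rule near_complementarity[OF \<beta>\<^sub>y])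
    also have "\<dots> \<le> \<epsilon> + norm u * (M\<^sub>p * \<epsilon>)"
      using kkt pclose by (intro add_mono mult_left_mono) (auto simp: eps_KKT_with_def)
    finally show ?thesis .
  qed
  moreover have "F x' y + gr x' \<le> F x y + gr x + (1 + diameter (edom g) * (1 + L\<^sub>F)) * \<epsilon>"
    using kkt unfolding eps_KKT_with_def
    by (intro primal_stationarity_bound[OF x' x _ _ close]) auto
  moreover have "F x y - hr y \<le> zeta_real x + D * (\<epsilon> + M\<^sub>p * \<epsilon>)"
  proof -
    obtain v where v: "0 \<le> v" "norm v \<le> D"
      and dual: "\<And>y. y \<in> edom h \<Longrightarrow> F x y - hr y - v \<bullet> p y \<le> zeta_real x"
      using inner_multiplier[OF x(1)] unfolding D_def by blast
    have "norm (pos_part (p y)) \<le> \<epsilon> + M\<^sub>p * \<epsilon>"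
      using norm_pos_part_le_diff[of "p y" "p y'"] pclose kkt by (simp add: eps_KKT_with_def)
    then have "norm v * norm (pos_part (p y)) \<le> D * (\<epsilon> + M\<^sub>p * \<epsilon>)"
      using v(2) by (intro mult_mono) (auto intro: order_trans[OF norm_ge_zero])
    then show ?thesis using inner_nonneg_le_pos_part[OF v(1), of "p y"] dual[OF y] by linarith
  qed
  ultimately show ?thesis unfolding D_def[symmetric] by (simp add: algebra_simps)
qed

text \<open>An outer multiplier \<open>z\<close> of the minimizer \<open>x\<close> prices the constraint violation of \<open>x'\<close>; its norm is
bounded through the Slater point \<open>x_feas\<close>.\<close>
lemma primal_gap_lower:
  assumes x': "x' \<in> edom g" and x: "x \<in> edom g"
    and min: "\<And>x'. x' \<in> edom g \<Longrightarrow> c x' \<le> 0 \<Longrightarrow> zeta_real x + gr x \<le> zeta_real x' + gr x'"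
    and viol: "norm (pos_part (c x')) \<le> \<epsilon>" and D: "\<Delta>\<^sub>y / p_feas \<le> D"
  shows "zeta_real x + gr x \<le> zeta_real x' + gr x' + (Delta_Psi F g h p \<beta>\<^sub>y D + max_diff g) / c_feas * \<epsilon>"
proof -
  have "convex_on (edom g) zeta_real"
    using nonsmooth_convex[OF g] by (intro convex_on_subset[OF zeta_real_convex]) (auto simp: convex_on_def)
  then have "concave_on (edom g) (\<lambda>x. - (zeta_real x + gr x))"
    unfolding concave_on_def minus_minus using nonsmooth_convex[OF g] by (rule convex_on_add)
  moreover have "convex_on (edom g) (\<lambda>x. c x $ i)" for i
    using nonsmooth_convex[OF g] by (intro constraint_convex[OF c]) (simp add: convex_on_def)
  moreover have "- (zeta_real x' + gr x') \<le> - (zeta_real x + gr x)" if "x' \<in> edom g" "c x' \<le> 0" for x'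
    using min[OF that] by simp
  ultimately obtain z where z: "0 \<le> z"
    and dual: "\<And>x'. x' \<in> edom g \<Longrightarrow> - (zeta_real x' + gr x') - z \<bullet> c x' \<le> - (zeta_real x + gr x)"
    and nz: "c_feas * norm z \<le> - (zeta_real x + gr x) - - (zeta_real x_feas + gr x_feas)"
    using slater_multiplier[of "edom g" "\<lambda>x. - (zeta_real x + gr x)" c x_feas c_feas "- (zeta_real x + gr x)"]
      x_feas c_feas c_slater by blast
  let ?B = "Delta_Psi F g h p \<beta>\<^sub>y D + max_diff g"
  have "c_feas * norm z \<le> ?B"
    using nz zeta_real_diff_le_Delta_Psi[OF x_feas x D] nonsmooth_diff_le_max_diff[OF g x_feas x] by linarith
  then have nz: "norm z \<le> ?B / c_feas" using c_feas by (simp add: field_simps)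
  have "z \<bullet> c x' \<le> norm z * norm (pos_part (c x'))" by (rule inner_nonneg_le_pos_part[OF z])
  also have "\<dots> \<le> ?B / c_feas * \<epsilon>"
    using nz viol by (intro mult_mono) (auto intro: order_trans[OF norm_ge_zero])
  finally show ?thesis using dual[OF x'] by linarith
qed

end

theorem theorem3p9:
  fixes F :: "real ^ 'n \<Rightarrow> real ^ 'm \<Rightarrow> real"
    and g :: "real ^ 'n \<Rightarrow> ereal" and h :: "real ^ 'm \<Rightarrow> ereal"
    and c :: "real ^ 'n \<Rightarrow> real ^ 'q" and p :: "real ^ 'm \<Rightarrow> real ^ 'r"
    and L\<^sub>F L\<^sub>c L\<^sub>p \<mu>\<^sub>F \<epsilon> \<beta>\<^sub>y \<beta>\<^sub>0 \<rho>\<^sub>0 \<eta>\<^sub>0 \<sigma> \<tau> :: real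
    and x_feas x\<^sub>0 x_out :: "real ^ 'n" and y_feas y\<^sub>0 y_out :: "real ^ 'm"
    and z\<^sub>0 z_out :: "real ^ 'q" and u\<^sub>0 u_out :: "real ^ 'r"
    and c_feas p_feas D\<^sub>u' D\<^sub>u D\<^sub>z' :: real
  assumes "smooth_coupling L\<^sub>F F"
    and "nonsmooth_term g" and "nonsmooth_term h"
    and "smooth_convex_constraint L\<^sub>c c" and "smooth_convex_constraint L\<^sub>p p"
    and "x_feas \<in> edom g" and "y_feas \<in> edom h"
    and "c_feas = (MIN i. - (c x_feas $ i))" and "c_feas > 0"
    and "p_feas = (MIN i. - (p y_feas $ i))" and "p_feas > 0"
    and "\<mu>\<^sub>F > 0" and "\<forall>x\<in>edom g. strongly_concave_on UNIV \<mu>\<^sub>F (F x)"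
    and "\<epsilon> > 0" and "x\<^sub>0 \<in> edom g" and "y\<^sub>0 \<in> edom h" and "0 \<le> u\<^sub>0" and "0 \<le> z\<^sub>0"
    and "\<beta>\<^sub>y > 0" and "\<beta>\<^sub>0 > 0" and "\<rho>\<^sub>0 > 0" and "\<eta>\<^sub>0 > 0" and "1 < \<sigma>" and "\<sigma> < \<tau>"
    and "alg_output F g h c p \<mu>\<^sub>F \<beta>\<^sub>y \<epsilon> \<beta>\<^sub>0 \<rho>\<^sub>0 \<eta>\<^sub>0 \<sigma> \<tau> x\<^sub>0 y\<^sub>0 u\<^sub>0 z\<^sub>0 x_out y_out z_out u_out"
    and "D\<^sub>u' = (Delta_F F g h + max_diff h) / p_feas"
    and "D\<^sub>u = max (norm u\<^sub>0) ((Delta_F F g h + max_diff h) / p_feas)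
               + \<eta>\<^sub>0 / \<rho>\<^sub>0 * (\<tau> / (\<tau> - \<sigma>)) + \<beta>\<^sub>y * \<eta>\<^sub>0 * (\<tau> / (\<tau> - 1))"
    and "D\<^sub>z' = (Delta_Psi F g h p \<beta>\<^sub>y D\<^sub>u + max_diff g) / c_feas"
  shows "primal_eps_optimal F g h c p
           (max (D\<^sub>u' + 2 + diameter (edom g) * (1 + L\<^sub>F)
                  + (\<beta>\<^sub>y * max_norm h p + D\<^sub>u + D\<^sub>u') * max_Jac_opnorm h p)
                D\<^sub>z' * \<epsilon>)
           x_out"
proof -
  have c_slater: "c x_feas $ i \<le> - c_feas" for i
  proof -
    have "c_feas \<le> - (c x_feas $ i)" unfolding assms(8) by (rule Min_le) auto
    then show ?thesis by simp
  qed
  have p_slater: "p y_feas $ i \<le> - p_feas" for i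
  proof -
    have "p_feas \<le> - (p y_feas $ i)" unfolding assms(10) by (rule Min_le) auto
    then show ?thesis by simp
  qed
  interpret minimax_problem F g h c p L\<^sub>F L\<^sub>c L\<^sub>p \<mu>\<^sub>F \<beta>\<^sub>y x_feas y_feas c_feas p_feas
    using assms(1-7,9,11-13,19) c_slater p_slater by unfold_locales auto
  obtain x y u z ut T where init: "u 0 = u\<^sub>0"
    and step: "\<And>t. t \<le> T \<Longrightarrow> alg_step F g h c p \<mu>\<^sub>F \<beta>\<^sub>y \<epsilon> (\<beta>\<^sub>0 * \<sigma> ^ t) (\<rho>\<^sub>0 / \<sigma> ^ t) (\<eta>\<^sub>0 / \<tau> ^ t)
                 (x t) (u t) (z t)
                 (x (Suc t)) (y (Suc t)) (u (Suc t)) (z (Suc t)) (ut (Suc t))"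
    and kkt: "eps_KKT_with F g h c p \<epsilon> (x (Suc T)) (y (Suc T)) (z (Suc T)) (ut (Suc T))"
    and out: "x_out = x (Suc T)"
    using assms(25) unfolding alg_output_def by blast
  have D\<^sub>u': "D\<^sub>u' = \<Delta>\<^sub>y / p_feas" using assms(26) .
  have D\<^sub>u'0: "0 \<le> D\<^sub>u'" unfolding D\<^sub>u' using \<Delta>\<^sub>y_nonneg p_feas by (rule divide_nonneg_pos)
  \<comment> \<open>The proximal bound, iterated: the maximum with \<open>D\<^sub>u'\<close> absorbs the iterations whose multiplier
      is shorter than \<open>D\<^sub>u'\<close>.\<close>
  have growth: "norm (u t) \<le> max (norm u\<^sub>0) D\<^sub>u' + \<eta>\<^sub>0 / \<rho>\<^sub>0 * (\<Sum>k<t. (\<sigma> / \<tau>) ^ k)" if "t \<le> Suc T" for t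
    using that
  proof (induction t)
    case 0
    then show ?case by (simp add: init)
  next
    case (Suc t)
    have "\<eta>\<^sub>0 / \<tau> ^ t / (\<rho>\<^sub>0 / \<sigma> ^ t) = \<eta>\<^sub>0 / \<rho>\<^sub>0 * (\<sigma> / \<tau>) ^ t" by (simp add: power_divide)
    moreover have "norm (u (Suc t)) \<le> max D\<^sub>u' (norm (u t) + \<eta>\<^sub>0 / \<tau> ^ t / (\<rho>\<^sub>0 / \<sigma> ^ t))"
      unfolding D\<^sub>u' using step[of t] Suc.prems assms(21-24)
      by (intro prox_step_multiplier_bound) (auto simp: alg_step_def)
    moreover have "0 \<le> (\<Sum>k<t. (\<sigma> / \<tau>) ^ k)" using assms(23,24) by (intro sum_nonneg) auto
    then have "0 \<le> \<eta>\<^sub>0 / \<rho>\<^sub>0 * (\<sigma> / \<tau>) ^ t" "0 \<le> \<eta>\<^sub>0 / \<rho>\<^sub>0 * (\<Sum>k<t. (\<sigma> / \<tau>) ^ k)"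
      using assms(21-24) by auto
    ultimately show ?case using Suc.IH Suc.prems by (simp add: distrib_left)
  qed
  have "(\<Sum>k<Suc T. (\<sigma> / \<tau>) ^ k) \<le> 1 / (1 - \<sigma> / \<tau>)"
    using assms(23,24) by (intro sum_power_le_geometric) auto
  also have "\<dots> = \<tau> / (\<tau> - \<sigma>)" using assms(23,24) by (simp add: field_simps)
  finally have "\<eta>\<^sub>0 / \<rho>\<^sub>0 * (\<Sum>k<Suc T. (\<sigma> / \<tau>) ^ k) \<le> \<eta>\<^sub>0 / \<rho>\<^sub>0 * (\<tau> / (\<tau> - \<sigma>))"
    using assms(21,22) by (intro mult_left_mono) auto
  moreover have pos: "0 \<le> \<beta>\<^sub>y * \<eta>\<^sub>0 * (\<tau> / (\<tau> - 1))" "0 \<le> \<eta>\<^sub>0 / \<rho>\<^sub>0 * (\<tau> / (\<tau> - \<sigma>))"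
    using assms(19,21-24) by auto
  moreover have D\<^sub>u: "D\<^sub>u = max (norm u\<^sub>0) D\<^sub>u' + \<eta>\<^sub>0 / \<rho>\<^sub>0 * (\<tau> / (\<tau> - \<sigma>)) + \<beta>\<^sub>y * \<eta>\<^sub>0 * (\<tau> / (\<tau> - 1))"
    using assms(26,27) by simp
  ultimately have u: "norm (u (Suc T)) \<le> D\<^sub>u" using growth[of "Suc T"] by linarith
  have D\<^sub>u'D\<^sub>u: "D\<^sub>u' \<le> D\<^sub>u" using D\<^sub>u pos by linarith
  let ?A = "D\<^sub>u' + 2 + diameter (edom g) * (1 + L\<^sub>F) + (\<beta>\<^sub>y * max_norm h p + D\<^sub>u + D\<^sub>u') * M\<^sub>p"
  have xT: "x_out \<in> edom g" and yT: "y (Suc T) \<in> edom h"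
    and utT: "ut (Suc T) = pos_part (\<beta>\<^sub>y *\<^sub>R p (y (Suc T)) + u (Suc T))"
    and approx: "dist0 {gradient (F x_out) (y (Suc T)) - v
          - transpose (Jac p (y (Suc T))) *v pos_part (\<beta>\<^sub>y *\<^sub>R p (y (Suc T)) + u (Suc T))
        | v. v \<in> subdiff h (y (Suc T))} \<le> ereal (min \<epsilon> (\<eta>\<^sub>0 / \<tau> ^ T) * \<mu>\<^sub>F)"
    using step[of T] out by (auto simp: alg_step_def)
  have approx: "dist0 {gradient (F x_out) (y (Suc T)) - v
          - transpose (Jac p (y (Suc T))) *v pos_part (\<beta>\<^sub>y *\<^sub>R p (y (Suc T)) + u (Suc T))
        | v. v \<in> subdiff h (y (Suc T))} \<le> ereal (\<epsilon> * \<mu>\<^sub>F)"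
    by (rule order_trans[OF approx]) (use \<mu>\<^sub>F in simp)
  note kkt = kkt[folded out, unfolded utT]
  obtain xs where xs: "xs \<in> edom g" "c xs \<le> 0"
    and min: "\<And>x. x \<in> edom g \<Longrightarrow> c x \<le> 0 \<Longrightarrow> zeta_real xs + gr xs \<le> zeta_real x + gr x"
    and arg_min: "is_arg_min (\<lambda>x. zeta F h p x + g x) (\<lambda>x. c x \<le> 0) xs"
    using primal_minimizer_exists by blast
  have M0: "0 \<le> M\<^sub>p" using p_lipschitz by (rule lipschitz_on_nonneg)
  have N0: "0 \<le> \<beta>\<^sub>y * max_norm h p"
    using max_norm_nonneg[OF p nonsmooth_compact[OF h]] y_feas \<beta>\<^sub>y
    by (intro mult_nonneg_nonneg) auto
  have "zeta_real x_out + gr x_out \<le> zeta_real xs + gr xs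
      + (D\<^sub>u' + 2 + diameter (edom g) * (1 + L\<^sub>F) + (norm (u (Suc T)) + D\<^sub>u') * M\<^sub>p) * \<epsilon>"
    unfolding D\<^sub>u' by (rule primal_gap_upper[OF xT yT xs \<open>\<epsilon> > 0\<close> kkt approx])
  also have "(norm (u (Suc T)) + D\<^sub>u') * M\<^sub>p \<le> (\<beta>\<^sub>y * max_norm h p + D\<^sub>u + D\<^sub>u') * M\<^sub>p"
    using u N0 M0 by (intro mult_right_mono) auto
  finally have upper: "zeta_real x_out + gr x_out \<le> zeta_real xs + gr xs + ?A * \<epsilon>"
    using \<open>\<epsilon> > 0\<close> by (simp add: mult_right_mono)
  have viol: "norm (pos_part (c x_out)) \<le> \<epsilon>" using kkt by (simp add: eps_KKT_with_def)
  have lower: "zeta_real xs + gr xs \<le> zeta_real x_out + gr x_out + D\<^sub>z' * \<epsilon>"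
    unfolding assms(28) using D\<^sub>u'D\<^sub>u by (intro primal_gap_lower[OF xT xs(1) min viol]) (simp_all add: D\<^sub>u')
  have le: "?A * \<epsilon> \<le> max ?A D\<^sub>z' * \<epsilon>" "D\<^sub>z' * \<epsilon> \<le> max ?A D\<^sub>z' * \<epsilon>"
    using \<open>\<epsilon> > 0\<close> by (intro mult_right_mono; simp)+
  have "bounded (edom g)" using nonsmooth_compact[OF g] by (rule compact_imp_bounded)
  moreover have "0 \<le> L\<^sub>F" using F unfolding smooth_coupling_def by (blast intro: lipschitz_on_nonneg)
  ultimately have "0 \<le> diameter (edom g) * (1 + L\<^sub>F)" using diameter_ge_0[of "edom g"] by simp
  moreover have "0 \<le> (\<beta>\<^sub>y * max_norm h p + D\<^sub>u + D\<^sub>u') * M\<^sub>p"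
    using M0 N0 D\<^sub>u'0 D\<^sub>u'D\<^sub>u by (intro mult_nonneg_nonneg) auto
  ultimately have "1 \<le> ?A" using D\<^sub>u'0 by linarith
  then have "1 * \<epsilon> \<le> ?A * \<epsilon>" using \<open>\<epsilon> > 0\<close> by (intro mult_right_mono) auto
  then have "norm (pos_part (c x_out)) \<le> max ?A D\<^sub>z' * \<epsilon>" using viol le by linarith
  moreover have "\<bar>(zeta_real x_out + gr x_out) - (zeta_real xs + gr xs)\<bar> \<le> max ?A D\<^sub>z' * \<epsilon>"
    using upper lower le by linarith
  moreover have total: "zeta F h p v + g v = ereal (zeta_real v + gr v)" if "v \<in> edom g" for v
  proof -
    have "zeta F h p v + g v = ereal (zeta_real v) + ereal (gr v)"
      unfolding zeta_eq nonsmooth_ereal[OF g that] ..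
    then show ?thesis by simp
  qed
  ultimately have "\<bar>(zeta F h p x_out + g x_out) - (zeta F h p xs + g xs)\<bar> \<le> ereal (max ?A D\<^sub>z' * \<epsilon>)"
    "norm (pos_part (c x_out)) \<le> max ?A D\<^sub>z' * \<epsilon>"
    by (simp_all add: total[OF xT] total[OF xs(1)])
  with arg_min show ?thesis unfolding primal_eps_optimal_def by blast
qed

end
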